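(* Let $Z=(Z^{(1)},Z^{(2)})$ be the semimartingale reflected Brownian motion in $\mathbb{R}_+^2$ with parameters $(\Sigma,\mu,R)$ started from $z_0\in\mathbb{R}_+^2$, with associated boundary processes $L^1,L^2$, and let $\widehat p,\widehat p_1,\widehat p_2$ be the Laplace transforms $$\widehat p(u,x,y)=\mathbb{E}_{z_0}\Big[\int_0^\infty e^{xZ_t^{(1)}+yZ_t^{(2)}+ut}\,dt\Big],\quad \widehat p_1(u,y)=\mathbb{E}_{z_0}\Big[\int_0^\infty e^{yZ_t^{(2)}+ut}\,dL_t^1\Big],\quad \widehat p_2(u,x)=\mathbb{E}_{z_0}\Big[\int_0^\infty e^{xZ_t^{(1)}+ut}\,dL_t^2\Big].$$ Then for all $x,y,u\in\mathbb{C}$ such that $\Re x<0$, $\Re y<0$ and $\Re u<0$, $$-\bigl(K(x,y)+u\bigr)\,\widehat p(u,x,y)=k_1(x,y)\,\widehat p_1(u,y)+k_2(x,y)\,\widehat p_2(u,x)+e^{\langle (x,y),z_0\rangle},$$ where $$K(x,y)=\tfrac12(x^2+y^2+2\rho xy)+\mu_1x+\mu_2y,\qquad k_1(x,y)=x+r_1y,\qquad k_2(x,y)=r_2x+y.$$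
   Context: Parameters: $\Sigma=\begin{pmatrix}1&\rho\\ \rho&1\end{pmatrix}$ with $\rho\in(-1,1)$, $\mu=(\mu_1,\mu_2)^\top\in\mathbb{R}^2$ with $\mu_1^2+\mu_2^2=1$, and $R=\begin{pmatrix}1&r_2\\ r_1&1\end{pmatrix}$ with $r_1,r_2\in\mathbb{R}$. It is assumed that ($1-r_1r_2>0$) or ($r_1>0$ and $r_2>0$), which is the necessary and sufficient condition for existence of the process; it is then unique in law for a given initial distribution. The semimartingale reflected Brownian motion (SRBM) in $\mathbb{R}_+^2$ with parameters $(\Sigma,\mu,R)$ started at $z_0$ is a continuous Markov process $Z_t=(Z_t^{(1)},Z_t^{(2)})^\top\in\mathbb{R}_+^2$ admitting the decomposition $Z_t=z_0+B_t+\mu t+RL_t$, where $B$ is a Brownian motion started at $0$ with covariance matrix $\Sigma$, and $L_t=(L_t^1,L_t^2)^\top$ is a continuous process started at $0$ with nondecreasing components such that $L^i$ increases only at times when the coordinate $Z^{(i)}$ equals $0$. $\mathbb{E}_{z_0}$ denotes expectation for the process started at $z_0$. For $z_0=(a,b)$, $\langle (x,y),z_0\rangle=ax+by$. The transform $\widehat p$ is the Laplace transform in time and space of the transition density $p(t,z_0,z)$ of $Z$, i.e. $\widehat p(u,x,y)=\int_{\mathbb{R}_+^2}\int_0^\infty e^{xz_1+yz_2+ut}p(t,z_0,z)\,dt\,dz$; the dependence of $\widehat p,\widehat p_1,\widehat p_2$ on $z_0$ is omitted from the notation. *)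

theory Defs
  imports "HOL-Probability.Probability"
begin

text \<open>
  Processes are functions of a real time, of which only times \<open>t \<ge> 0\<close> matter.  A filtration is
  indexed by all reals to fit the library locale; a filtration given on \<open>[0, \<infinity>)\<close> is extended by
  \<open>F t = F 0\<close> for \<open>t < 0\<close>.
\<close>

definition filtered_prob_space :: "'a measure \<Rightarrow> (real \<Rightarrow> 'a measure) \<Rightarrow> bool" where
  "filtered_prob_space M F \<longleftrightarrow>
     prob_space M \<and> filtration (space M) F \<and> (\<forall>t. subalgebra M (F t))"

definition adapted_process ::
  "(real \<Rightarrow> 'a measure) \<Rightarrow> (real \<Rightarrow> 'a \<Rightarrow> 'b::topological_space) \<Rightarrow> bool" where
  "adapted_process F X \<longleftrightarrow> (\<forall>t\<ge>0. X t \<in> F t \<rightarrow>\<^sub>M borel)"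

definition continuous_paths ::
  "'a measure \<Rightarrow> (real \<Rightarrow> 'a \<Rightarrow> 'b::topological_space) \<Rightarrow> bool" where
  "continuous_paths M X \<longleftrightarrow> (\<forall>\<omega>\<in>space M. continuous_on {0..} (\<lambda>t. X t \<omega>))"

text \<open>
  A centred Gaussian vector: every nontrivial linear combination of its coordinates is a centred
  normal variable with the prescribed variance.  The covariance matrix must be positive definite,
  since \<open>normal_density\<close> takes the standard deviation and describes nondegenerate laws only.
\<close>

definition centred_gaussian ::
  "'a measure \<Rightarrow> real^'n^'n \<Rightarrow> ('a \<Rightarrow> real^'n) \<Rightarrow> bool" where
  "centred_gaussian M C X \<longleftrightarrow>
     (\<forall>v. v \<noteq> 0 \<longrightarrow>
        distributed M lborel (\<lambda>\<omega>. v \<bullet> X \<omega>) (normal_density 0 (sqrt (v \<bullet> (C *v v)))))"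

definition brownian_motion ::
  "'a measure \<Rightarrow> (real \<Rightarrow> 'a measure) \<Rightarrow> real^'n^'n \<Rightarrow> (real \<Rightarrow> 'a \<Rightarrow> real^'n) \<Rightarrow> bool" where
  "brownian_motion M F C B \<longleftrightarrow>
     adapted_process F B \<and>
     continuous_paths M B \<and>
     (\<forall>\<omega>\<in>space M. B 0 \<omega> = 0) \<and>
     (\<forall>s t. 0 \<le> s \<and> s < t \<longrightarrow>
        centred_gaussian M ((t - s) *\<^sub>R C) (\<lambda>\<omega>. B t \<omega> - B s \<omega>) \<and>
        prob_space.indep_set M (sets (F s))
          (sets (vimage_algebra (space M) (\<lambda>\<omega>. B t \<omega> - B s \<omega>) borel)))"

definition markov_process ::
  "'a measure \<Rightarrow> (real \<Rightarrow> 'a measure) \<Rightarrow> (real \<Rightarrow> 'a \<Rightarrow> 'b::topological_space) \<Rightarrow> bool" where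
  "markov_process M F X \<longleftrightarrow>
     adapted_process F X \<and>
     (\<forall>s t. 0 \<le> s \<and> s \<le> t \<longrightarrow> (\<forall>A\<in>sets borel.
        AE \<omega> in M.
          real_cond_exp M (F s) (\<lambda>\<omega>'. indicator A (X t \<omega>')) \<omega> =
          real_cond_exp M (vimage_algebra (space M) (X s) borel) (\<lambda>\<omega>'. indicator A (X t \<omega>')) \<omega>))"

text \<open>
  The Stieltjes measure \<open>dl\<close> of a continuous nondecreasing function on \<open>[0, \<infinity>)\<close>.  Continuing
  \<open>l\<close> by the constant \<open>l 0\<close> to the left of \<open>0\<close> makes the negative half line a null set and puts
  no atom at \<open>0\<close>.
\<close>

definition stieltjes :: "(real \<Rightarrow> real) \<Rightarrow> real measure" where
  "stieltjes l = interval_measure (\<lambda>t. l (max 0 t))"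

text \<open>
  SRBM in the nonnegative orthant with covariance \<open>C\<close>, drift \<open>m\<close> and reflection matrix \<open>R\<close>.
  As usual for semimartingales, one filtration carries all the data: \<open>Z\<close> and \<open>L\<close> are adapted to
  it and \<open>B\<close> is a Brownian motion relative to it.  The last clause says that \<open>L\<^sup>i\<close> increases
  only when the \<open>i\<close>-th coordinate of \<open>Z\<close> vanishes.
\<close>

definition srbm ::
  "'a measure \<Rightarrow> (real \<Rightarrow> 'a measure) \<Rightarrow> real^'n^'n \<Rightarrow> real^'n \<Rightarrow> real^'n^'n \<Rightarrow> real^'n \<Rightarrow>
   (real \<Rightarrow> 'a \<Rightarrow> real^'n) \<Rightarrow> (real \<Rightarrow> 'a \<Rightarrow> real^'n) \<Rightarrow> (real \<Rightarrow> 'a \<Rightarrow> real^'n) \<Rightarrow> bool" where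
  "srbm M F C m R z0 Z B L \<longleftrightarrow>
     filtered_prob_space M F \<and>
     brownian_motion M F C B \<and>
     markov_process M F Z \<and>
     continuous_paths M Z \<and>
     adapted_process F L \<and>
     continuous_paths M L \<and>
     (\<forall>\<omega>\<in>space M.
        (\<forall>t\<ge>0. \<forall>i. 0 \<le> Z t \<omega> $ i) \<and>
        (\<forall>t\<ge>0. Z t \<omega> = z0 + B t \<omega> + t *\<^sub>R m + R *v L t \<omega>) \<and>
        L 0 \<omega> = 0 \<and>
        (\<forall>i. mono_on {0..} (\<lambda>t. L t \<omega> $ i)) \<and>
        (\<forall>i. AE t in stieltjes (\<lambda>s. L s \<omega> $ i). 0 \<le> t \<longrightarrow> Z t \<omega> $ i = 0))"

definition cov_matrix :: "real \<Rightarrow> real^2^2" where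
  "cov_matrix \<rho> = vector [vector [1, \<rho>], vector [\<rho>, 1]]"

definition refl_matrix :: "real \<Rightarrow> real \<Rightarrow> real^2^2" where
  "refl_matrix r1 r2 = vector [vector [1, r2], vector [r1, 1]]"

text \<open>
  The expectation of \<open>\<integral>\<^sub>0\<^sup>\<infinity> f \<omega> t N \<omega> (dt)\<close> for a random measure \<open>N\<close>.  Library integrals are
  \<open>0\<close> by convention where they do not exist, so existence is stated separately: the inner integral
  converges absolutely almost surely, and the resulting random variable is integrable.
\<close>

definition path_expectation ::
  "'a measure \<Rightarrow> ('a \<Rightarrow> real measure) \<Rightarrow> ('a \<Rightarrow> real \<Rightarrow> complex) \<Rightarrow> complex" where
  "path_expectation M N f = (LINT \<omega>|M. (LINT t:{0..}|N \<omega>. f \<omega> t))"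

definition path_expectation_exists ::
  "'a measure \<Rightarrow> ('a \<Rightarrow> real measure) \<Rightarrow> ('a \<Rightarrow> real \<Rightarrow> complex) \<Rightarrow> bool" where
  "path_expectation_exists M N f \<longleftrightarrow>
     (AE \<omega> in M. set_integrable (N \<omega>) {0..} (f \<omega>)) \<and>
     integrable M (\<lambda>\<omega>. LINT t:{0..}|N \<omega>. f \<omega> t)"

definition integrand ::
  "(real \<Rightarrow> 'a \<Rightarrow> real^2) \<Rightarrow> complex \<Rightarrow> complex \<Rightarrow> complex \<Rightarrow> 'a \<Rightarrow> real \<Rightarrow> complex" where
  "integrand Z u x y \<omega> t =
     exp (x * of_real (Z t \<omega> $ 1) + y * of_real (Z t \<omega> $ 2) + u * of_real t)"

definition p_hat ::
  "'a measure \<Rightarrow> (real \<Rightarrow> 'a \<Rightarrow> real^2) \<Rightarrow> complex \<Rightarrow> complex \<Rightarrow> complex \<Rightarrow> complex" where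
  "p_hat M Z u x y = path_expectation M (\<lambda>_. lborel) (integrand Z u x y)"

definition p1_hat ::
  "'a measure \<Rightarrow> (real \<Rightarrow> 'a \<Rightarrow> real^2) \<Rightarrow> (real \<Rightarrow> 'a \<Rightarrow> real^2) \<Rightarrow> complex \<Rightarrow> complex \<Rightarrow> complex" where
  "p1_hat M Z L u y =
     path_expectation M (\<lambda>\<omega>. stieltjes (\<lambda>s. L s \<omega> $ 1)) (integrand Z u 0 y)"

definition p2_hat ::
  "'a measure \<Rightarrow> (real \<Rightarrow> 'a \<Rightarrow> real^2) \<Rightarrow> (real \<Rightarrow> 'a \<Rightarrow> real^2) \<Rightarrow> complex \<Rightarrow> complex \<Rightarrow> complex" where
  "p2_hat M Z L u x =
     path_expectation M (\<lambda>\<omega>. stieltjes (\<lambda>s. L s \<omega> $ 2)) (integrand Z u x 0)"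

definition kernel_K :: "real \<Rightarrow> real^2 \<Rightarrow> complex \<Rightarrow> complex \<Rightarrow> complex" where
  "kernel_K \<rho> m x y =
     (x\<^sup>2 + y\<^sup>2 + 2 * of_real \<rho> * x * y) / 2 + of_real (m $ 1) * x + of_real (m $ 2) * y"

definition kernel_k1 :: "real \<Rightarrow> complex \<Rightarrow> complex \<Rightarrow> complex" where
  "kernel_k1 r1 x y = x + of_real r1 * y"

definition kernel_k2 :: "real \<Rightarrow> complex \<Rightarrow> complex \<Rightarrow> complex" where
  "kernel_k2 r2 x y = of_real r2 * x + y"

end

theory Submission
  imports Defs "HOL-Complex_Analysis.Complex_Analysis"
begin

text \<open>
  Write \<open>Y\<^sub>t = x Z\<^sup>1\<^sub>t + y Z\<^sup>2\<^sub>t + u t\<close> and \<open>W = x B\<^sup>1 + y B\<^sup>2\<close>.  Stochastic calculus is avoided by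
  factoring \<open>exp Y = N V\<close>, where \<open>N\<^sub>t = exp (W\<^sub>t - q t / 2)\<close> with \<open>q = x\<^sup>2 + y\<^sup>2 + 2 \<rho> x y\<close> is an
  explicit complex martingale and \<open>V\<close> has continuous paths of finite variation with
  \<open>dV = V ((K + u) dt + k\<^sub>1 dL\<^sup>1 + k\<^sub>2 dL\<^sup>2)\<close>.  Summing by parts over a partition of \<open>[0, T]\<close>, the
  sums for \<open>\<integral> N dV\<close> equal \<open>exp Y\<^sub>T - exp Y\<^sub>0\<close> minus a sum of orthogonal martingale differences.
  Since \<open>|exp Y| \<le> 1\<close>, the latter is bounded in \<open>L\<^sup>2\<close> uniformly in the mesh, which gives
  \<open>E \<integral>\<^sub>0\<^sup>T N dV = E exp Y\<^sub>T - exp Y\<^sub>0\<close> in the limit; then \<open>T \<rightarrow> \<infinity>\<close>.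

  The three integrals are separately integrable because the condition on the reflection matrix
  provides small \<open>w > 0\<close> with \<open>w\<^sub>1 + r\<^sub>1 w\<^sub>2 > 0\<close> and \<open>r\<^sub>2 w\<^sub>1 + w\<^sub>2 > 0\<close>.  For \<open>x = - w\<^sub>1\<close> and
  \<open>y = - w\<^sub>2\<close> the path \<open>V\<close> is nonincreasing, so that the same sums bound \<open>E \<integral> exp Y dL\<^sup>i\<close>.
\<close>

section \<open>Exponential moments of Gaussian vectors\<close>

text \<open>Completing the square turns \<open>exp s\<close> times the centred normal density into
  \<open>exp (\<sigma>\<^sup>2 / 2)\<close> times the normal density with mean
  \<open>\<sigma>\<^sup>2\<close>, whose total mass is 1.\<close>

lemma distributed_normal_exp_moment:
  assumes "0 < \<sigma>" "distributed M lborel X (normal_density 0 \<sigma>)"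
  shows "integrable M (\<lambda>\<omega>. exp (X \<omega>))"
    and "(LINT \<omega>|M. exp (X \<omega>)) = exp (\<sigma>\<^sup>2 / 2)"
proof -
  have tilt: "normal_density 0 \<sigma> s * exp s = exp (\<sigma>\<^sup>2 / 2) * normal_density (\<sigma>\<^sup>2) \<sigma> s" for s
  proof -
    have "- s\<^sup>2 / (2 * \<sigma>\<^sup>2) + s = \<sigma>\<^sup>2 / 2 - (s - \<sigma>\<^sup>2)\<^sup>2 / (2 * \<sigma>\<^sup>2)"
      using assms(1) by (simp add: divide_simps) (simp add: power2_eq_square power4_eq_xxxx algebra_simps)
    then have "exp (- s\<^sup>2 / (2 * \<sigma>\<^sup>2)) * exp s
        = exp (\<sigma>\<^sup>2 / 2) * exp (- (s - \<sigma>\<^sup>2)\<^sup>2 / (2 * \<sigma>\<^sup>2))"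
      by (simp flip: exp_add)
    then show ?thesis by (simp add: normal_density_def)
  qed
  show "integrable M (\<lambda>\<omega>. exp (X \<omega>))"
    using distributed_integrable[OF assms(2), of "exp :: real \<Rightarrow> real"] assms(1) by (simp add: tilt)
  show "(LINT \<omega>|M. exp (X \<omega>)) = exp (\<sigma>\<^sup>2 / 2)"
    using distributed_integral[OF assms(2), of "exp :: real \<Rightarrow> real"] assms(1) by (simp add: tilt)
qed

text \<open>Expanding the exponential in \<open>z * V\<close> exhibits the expectation as an
  everywhere convergent power series in \<open>z\<close>. The partial sums are dominated with the
  help of the real exponential moments at \<open>cmod z\<close> and \<open>- cmod z\<close>, because
  \<open>exp \<bar>a\<bar> \<le> exp a + exp (- a)\<close>.\<close>

lemma (in prob_space) holomorphic_expectation_exp: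
  fixes U V :: "'a \<Rightarrow> real"
  assumes [measurable]: "random_variable borel U" "random_variable borel V"
    and int: "\<And>s. integrable M (\<lambda>\<omega>. exp (U \<omega> + s * V \<omega>))"
  shows "integrable M (\<lambda>\<omega>. exp (of_real (U \<omega>) + z * of_real (V \<omega>)) :: complex)"
    and "(\<lambda>z. LINT \<omega>|M. exp (of_real (U \<omega>) + z * of_real (V \<omega>)) :: complex) holomorphic_on UNIV"
proof -
  show *: "integrable M (\<lambda>\<omega>. exp (of_real (U \<omega>) + z * of_real (V \<omega>)) :: complex)" for z
    by (rule Bochner_Integration.integrable_bound[OF int[of "Re z"]]) auto
  define a where "a n = (LINT \<omega>|M. of_real (exp (U \<omega>) * V \<omega> ^ n) / fact n :: complex)" for n
  have sums: "(\<lambda>n. a n * z ^ n) sums (LINT \<omega>|M. exp (of_real (U \<omega>) + z * of_real (V \<omega>)))"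
    for z :: complex
  proof -
    define b where "b n \<omega> = exp (of_real (U \<omega>)) * ((z * of_real (V \<omega>)) ^ n / fact n)" for n \<omega>
    let ?D = "\<lambda>\<omega>. exp (U \<omega> + cmod z * V \<omega>) + exp (U \<omega> + (- cmod z) * V \<omega>)"
    have D: "integrable M ?D"
      by (intro Bochner_Integration.integrable_add int)
    have bs: "b n \<in> borel_measurable M" for n
      unfolding b_def by measurable
    have bsum: "(\<lambda>n. b n \<omega>) sums exp (of_real (U \<omega>) + z * of_real (V \<omega>))" for \<omega>
      unfolding b_def exp_add using exp_converges[of "z * of_real (V \<omega>)"]
      by (intro sums_mult) (simp add: scaleR_conv_of_real field_simps)
    have partial: "(\<Sum>n<k. norm (b n \<omega>)) \<le> ?D \<omega>" for k \<omega>
    proof -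
      have "(\<Sum>n<k. norm (b n \<omega>)) = exp (U \<omega>) * (\<Sum>n<k. (cmod z * \<bar>V \<omega>\<bar>) ^ n / fact n)"
        by (simp add: b_def sum_distrib_left norm_mult norm_divide norm_power)
      also have "\<dots> \<le> exp (U \<omega>) * exp (cmod z * \<bar>V \<omega>\<bar>)"
      proof (rule mult_left_mono)
        have "(\<lambda>n. (cmod z * \<bar>V \<omega>\<bar>) ^ n / fact n) sums exp (cmod z * \<bar>V \<omega>\<bar>)"
          using exp_converges[of "cmod z * \<bar>V \<omega>\<bar>"] by (simp add: field_simps)
        from sum_le_suminf[OF sums_summable[OF this], of "{..<k}"] sums_unique[OF this]
        show "(\<Sum>n<k. (cmod z * \<bar>V \<omega>\<bar>) ^ n / fact n) \<le> exp (cmod z * \<bar>V \<omega>\<bar>)"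
          by simp
      qed simp
      also have "\<dots> \<le> ?D \<omega>"
        unfolding exp_add[symmetric] by (cases "V \<omega> \<ge> 0") simp_all
      finally show ?thesis .
    qed
    have bi: "integrable M (b n)" for n
    proof (rule Bochner_Integration.integrable_bound[OF D bs])
      show "AE \<omega> in M. norm (b n \<omega>) \<le> norm (?D \<omega>)"
      proof (rule AE_I2)
        fix \<omega>
        have "norm (b n \<omega>) \<le> (\<Sum>n<Suc n. norm (b n \<omega>))"
          by (intro member_le_sum) auto
        also have "\<dots> \<le> ?D \<omega>" by (rule partial)
        finally show "norm (b n \<omega>) \<le> norm (?D \<omega>)" by simp
      qed
    qed
    have "(\<lambda>k. LINT \<omega>|M. (\<Sum>n<k. b n \<omega>)) \<longlonglongrightarrow> (LINT \<omega>|M. exp (of_real (U \<omega>) + z * of_real (V \<omega>)))"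
    proof (rule integral_dominated_convergence[where w="?D"])
      show "AE \<omega> in M. norm (\<Sum>n<k. b n \<omega>) \<le> ?D \<omega>" for k
        
      proof (rule AE_I2)
        fix \<omega>
        have "norm (\<Sum>n<k. b n \<omega>) \<le> (\<Sum>n<k. norm (b n \<omega>))" by (rule norm_sum)
        also have "\<dots> \<le> ?D \<omega>" by (rule partial)
        finally show "norm (\<Sum>n<k. b n \<omega>) \<le> ?D \<omega>" .
      qed
      show "AE \<omega> in M. (\<lambda>k. \<Sum>n<k. b n \<omega>) \<longlonglongrightarrow> exp (of_real (U \<omega>) + z * of_real (V \<omega>))"
        using bsum by (auto simp: sums_def)
    qed (use bs D in auto)
    moreover have "(LINT \<omega>|M. (\<Sum>n<k. b n \<omega>)) = (\<Sum>n<k. a n * z ^ n)" for k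
    proof -
      have "(LINT \<omega>|M. b n \<omega>) = a n * z ^ n" for n
        unfolding a_def integral_mult_left_zero[symmetric] b_def
        by (intro Bochner_Integration.integral_cong) (auto simp: exp_of_real power_mult_distrib)
      then show ?thesis using bi by (subst Bochner_Integration.integral_sum) auto
    qed
    ultimately show ?thesis by (simp add: sums_def)
  qed
  show "(\<lambda>z. LINT \<omega>|M. exp (of_real (U \<omega>) + z * of_real (V \<omega>)) :: complex) holomorphic_on UNIV"
  proof -
    have "(\<lambda>z. LINT \<omega>|M. exp (of_real (U \<omega>) + z * of_real (V \<omega>)) :: complex)
        holomorphic_on ball 0 r" for r
      by (rule power_series_holomorphic[where a=a]) (use sums in auto)
    then have "(\<lambda>z. LINT \<omega>|M. exp (of_real (U \<omega>) + z * of_real (V \<omega>)) :: complex)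
        field_differentiable (at z)" for z
      using holomorphic_on_imp_differentiable_at[OF _ open_ball, of _ 0 "norm z + 1" z] by simp
    then show ?thesis
      by (simp add: holomorphic_on_def)
  qed
qed

lemma (in prob_space) centred_gaussian_real_exp_moment:
  fixes C :: "real^'n^'n" and X :: "'a \<Rightarrow> real^'n"
  assumes "centred_gaussian M C X" and pos: "\<forall>v. v \<noteq> 0 \<longrightarrow> 0 < v \<bullet> (C *v v)"
  shows "integrable M (\<lambda>\<omega>. exp (v \<bullet> X \<omega>))"
    and "(LINT \<omega>|M. exp (v \<bullet> X \<omega>)) = exp (v \<bullet> (C *v v) / 2)"
proof -
  have "integrable M (\<lambda>\<omega>. exp (v \<bullet> X \<omega>)) \<and> (LINT \<omega>|M. exp (v \<bullet> X \<omega>)) = exp (v \<bullet> (C *v v) / 2)"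
  proof (cases "v = 0")
    case False
    let ?\<sigma> = "sqrt (v \<bullet> (C *v v))"
    have "distributed M lborel (\<lambda>\<omega>. v \<bullet> X \<omega>) (normal_density 0 ?\<sigma>)" "0 < ?\<sigma>"
      using assms False by (auto simp: centred_gaussian_def)
    from distributed_normal_exp_moment[OF this(2,1)] show ?thesis
      using pos False by (simp add: less_imp_le)
  qed (simp add: prob_space)
  then show "integrable M (\<lambda>\<omega>. exp (v \<bullet> X \<omega>))"
    "(LINT \<omega>|M. exp (v \<bullet> X \<omega>)) = exp (v \<bullet> (C *v v) / 2)" by auto
qed

text \<open>The definition of a Gaussian vector only speaks about real linear combinations;
  the complex ones are reached by analytic continuation.\<close>

lemma (in prob_space) centred_gaussian_exp_moment:
  fixes C :: "real^'n^'n" and X :: "'a \<Rightarrow> real^'n" and a b :: "real^'n" and z :: complex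
  assumes [measurable]: "random_variable borel X" and gauss: "centred_gaussian M C X"
    and pos: "\<forall>v. v \<noteq> 0 \<longrightarrow> 0 < v \<bullet> (C *v v)"
  shows "integrable M (\<lambda>\<omega>. exp (of_real (a \<bullet> X \<omega>) + z * of_real (b \<bullet> X \<omega>)) :: complex)"
    and "(LINT \<omega>|M. exp (of_real (a \<bullet> X \<omega>) + z * of_real (b \<bullet> X \<omega>))) =
      exp ((of_real (a \<bullet> (C *v a)) + z * of_real (a \<bullet> (C *v b) + b \<bullet> (C *v a))
        + z\<^sup>2 * of_real (b \<bullet> (C *v b))) / 2)"
proof -
  note rl = centred_gaussian_real_exp_moment[OF gauss pos]
  have split: "a \<bullet> X \<omega> + s * (b \<bullet> X \<omega>) = (a + s *\<^sub>R b) \<bullet> X \<omega>" for s \<omega>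
    by (simp add: inner_add_left)
  have int: "integrable M (\<lambda>\<omega>. exp (a \<bullet> X \<omega> + s * (b \<bullet> X \<omega>)))" for s
    unfolding split by (rule rl)
  show "integrable M (\<lambda>\<omega>. exp (of_real (a \<bullet> X \<omega>) + z * of_real (b \<bullet> X \<omega>)) :: complex)"
    by (rule holomorphic_expectation_exp[OF _ _ int]) measurable
  define f where "f z = (LINT \<omega>|M. exp (of_real (a \<bullet> X \<omega>) + z * of_real (b \<bullet> X \<omega>)))" for z :: complex
  define g where "g z = exp ((of_real (a \<bullet> (C *v a)) + z * of_real (a \<bullet> (C *v b) + b \<bullet> (C *v a))
        + z\<^sup>2 * of_real (b \<bullet> (C *v b))) / 2)" for z :: complex
  have holf: "f holomorphic_on UNIV"
    unfolding f_def by (rule holomorphic_expectation_exp[OF _ _ int]) measurable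
  have holg: "g holomorphic_on UNIV"
    unfolding g_def by (intro holomorphic_intros) auto
  \<comment> \<open>For real \<open>s\<close> the exponent is the single real combination
    \<open>(a + s *\<^sub>R b) \<bullet> X \<omega>\<close>, so the real moment applies. Both mixed
    terms are kept in the quadratic form, since \<open>C\<close> is not assumed symmetric.\<close>
  have real_eq: "f (of_real s) - g (of_real s) = 0" for s :: real
  proof -
    have "f (of_real s) = (LINT \<omega>|M. of_real (exp ((a + s *\<^sub>R b) \<bullet> X \<omega>)))"
      unfolding f_def by (simp add: exp_of_real[symmetric] inner_add_left)
    also have "\<dots> = of_real (LINT \<omega>|M. exp ((a + s *\<^sub>R b) \<bullet> X \<omega>))"
      by (rule integral_complex_of_real)
    also have "\<dots> = of_real (exp ((a + s *\<^sub>R b) \<bullet> (C *v (a + s *\<^sub>R b)) / 2))"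
      by (simp only: rl)
    also have "(a + s *\<^sub>R b) \<bullet> (C *v (a + s *\<^sub>R b)) =
        a \<bullet> (C *v a) + s * (a \<bullet> (C *v b) + b \<bullet> (C *v a)) + s\<^sup>2 * (b \<bullet> (C *v b))"
      by (simp add: matrix_vector_right_distrib matrix_vector_mult_scaleR inner_add_left
          inner_add_right power2_eq_square algebra_simps)
    finally show ?thesis by (simp add: g_def exp_of_real[symmetric])
  qed
  \<comment> \<open>Identity theorem: an entire function that vanishes on the reals, which
    accumulate at 0, vanishes everywhere.\<close>
  have "f z - g z = 0"
  proof (rule analytic_continuation[where f="\<lambda>z. f z - g z" and S=UNIV and U="\<real>" and \<xi>=0])
    show "(0::complex) islimpt \<real>"
      unfolding islimpt_approachable
    proof (intro allI impI)
      fix e :: real assume "0 < e"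
      then show "\<exists>x'\<in>\<real>. x' \<noteq> (0::complex) \<and> dist x' 0 < e"
        by (intro bexI[of _ "of_real (e / 2)"]) auto
    qed
    show "f w - g w = 0" if "w \<in> \<real>" for w
      using that real_eq by (auto elim: Reals_cases)
  qed (auto intro!: holomorphic_intros holf holg)
  then show "(LINT \<omega>|M. exp (of_real (a \<bullet> X \<omega>) + z * of_real (b \<bullet> X \<omega>))) =
      exp ((of_real (a \<bullet> (C *v a)) + z * of_real (a \<bullet> (C *v b) + b \<bullet> (C *v a))
        + z\<^sup>2 * of_real (b \<bullet> (C *v b))) / 2)"
    by (simp add: f_def g_def)
qed

section \<open>Limits in mean and martingale transforms\<close>

lemma square_add_le: "(a + b)\<^sup>2 \<le> 2 * a\<^sup>2 + 2 * (b::real)\<^sup>2"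
  using zero_le_power2[of "a - b"] by (simp add: power2_eq_square algebra_simps)

text \<open>Bounded second moments give uniform integrability, which upgrades almost sure
  convergence to convergence of means. The application is to sums over a partition whose second
  moments are bounded uniformly in the mesh.\<close>

lemma (in prob_space) expectation_tendsto_L2_bounded:
  fixes X :: "nat \<Rightarrow> 'a \<Rightarrow> 'b::{banach, second_countable_topology}"
  assumes [measurable]: "\<And>n. random_variable borel (X n)" "random_variable borel Y"
    and lim: "AE \<omega> in M. (\<lambda>n. X n \<omega>) \<longlonglongrightarrow> Y \<omega>"
    and int: "\<And>n. integrable M (\<lambda>\<omega>. (norm (X n \<omega>))\<^sup>2)"
    and bound: "\<And>n. (LINT \<omega>|M. (norm (X n \<omega>))\<^sup>2) \<le> C"
  shows "integrable M Y" and "(\<lambda>n. LINT \<omega>|M. X n \<omega>) \<longlonglongrightarrow> (LINT \<omega>|M. Y \<omega>)"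
proof -
  have C0: "0 \<le> C"
    by (rule order_trans[OF _ bound[of 0]]) simp
  have L1: "integrable M W" if [measurable]: "random_variable borel W"
    and "integrable M (\<lambda>\<omega>. (norm (W \<omega>))\<^sup>2)" for W :: "'a \<Rightarrow> 'b"
    using square_integrable_imp_integrable[of "\<lambda>\<omega>. norm (W \<omega>)"] that
    by (simp add: integrable_norm_iff)
  \<comment> \<open>Fatou's lemma passes the bound \<open>C\<close> on second moments to the
    limit.\<close>
  have "(\<integral>\<^sup>+\<omega>. ennreal ((norm (Y \<omega>))\<^sup>2) \<partial>M)
      = (\<integral>\<^sup>+\<omega>. liminf (\<lambda>n. ennreal ((norm (X n \<omega>))\<^sup>2)) \<partial>M)"
  proof (rule nn_integral_cong_AE)
    show "AE \<omega> in M. ennreal ((norm (Y \<omega>))\<^sup>2) = liminf (\<lambda>n. ennreal ((norm (X n \<omega>))\<^sup>2))"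
      using lim
    proof eventually_elim
      case (elim \<omega>)
      then have "(\<lambda>n. ennreal ((norm (X n \<omega>))\<^sup>2)) \<longlonglongrightarrow> ennreal ((norm (Y \<omega>))\<^sup>2)"
        by (intro tendsto_intros)
      then show ?case by (metis lim_imp_Liminf sequentially_bot)
    qed
  qed
  also have "\<dots> \<le> liminf (\<lambda>n. \<integral>\<^sup>+\<omega>. ennreal ((norm (X n \<omega>))\<^sup>2) \<partial>M)"
    by (rule nn_integral_liminf) measurable
  also have "\<dots> \<le> liminf (\<lambda>n. ennreal C)"
    using bound by (intro Liminf_mono always_eventually allI) 
      (simp add: nn_integral_eq_integral[OF int] ennreal_leI)
  finally have Y2: "(\<integral>\<^sup>+\<omega>. ennreal ((norm (Y \<omega>))\<^sup>2) \<partial>M) \<le> ennreal C"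
    by (simp add: Liminf_const)
  have intY: "integrable M (\<lambda>\<omega>. (norm (Y \<omega>))\<^sup>2)"
    using Y2 by (intro integrableI_nonneg) (auto intro: le_less_trans)
  have boundY: "(LINT \<omega>|M. (norm (Y \<omega>))\<^sup>2) \<le> C"
    using Y2 C0 by (simp add: nn_integral_eq_integral[OF intY])
  show Y1: "integrable M Y"
    by (rule L1[OF _ intY]) simp
  have X1: "integrable M (X n)" for n
    by (rule L1[OF _ int]) simp
  define D where "D n \<omega> = norm (X n \<omega> - Y \<omega>)" for n \<omega>
  have [measurable]: "random_variable borel (D n)" for n
    unfolding D_def by measurable
  have Dle: "(D n \<omega>)\<^sup>2 \<le> 2 * (norm (X n \<omega>))\<^sup>2 + 2 * (norm (Y \<omega>))\<^sup>2" for n \<omega>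
  proof -
    have "(D n \<omega>)\<^sup>2 \<le> (norm (X n \<omega>) + norm (Y \<omega>))\<^sup>2"
      unfolding D_def by (intro power_mono norm_triangle_ineq4) auto
    then show ?thesis using square_add_le order_trans by blast
  qed
  have Dint2: "integrable M (\<lambda>\<omega>. (D n \<omega>)\<^sup>2)" for n
    by (rule Bochner_Integration.integrable_bound[where
          f="\<lambda>\<omega>. 2 * (norm (X n \<omega>))\<^sup>2 + 2 * (norm (Y \<omega>))\<^sup>2"])
       (use Dle int intY in \<open>auto intro!: AE_I2\<close>)
  have D2: "(LINT \<omega>|M. (D n \<omega>)\<^sup>2) \<le> 4 * C" for n
  proof -
    have "(LINT \<omega>|M. (D n \<omega>)\<^sup>2) \<le> (LINT \<omega>|M. 2 * (norm (X n \<omega>))\<^sup>2 + 2 * (norm (Y \<omega>))\<^sup>2)"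
      using Dint2 int intY Dle by (intro integral_mono) auto
    also have "\<dots> = 2 * (LINT \<omega>|M. (norm (X n \<omega>))\<^sup>2) + 2 * (LINT \<omega>|M. (norm (Y \<omega>))\<^sup>2)"
      using int intY by simp
    finally show ?thesis using bound[of n] boundY by simp
  qed
  have D1: "integrable M (D n)" for n
    unfolding D_def using X1 Y1 by auto
  have D0: "AE \<omega> in M. (\<lambda>n. D n \<omega>) \<longlonglongrightarrow> 0"
    using lim by eventually_elim (simp add: D_def tendsto_norm_zero LIM_zero)
  have "(\<lambda>n. LINT \<omega>|M. D n \<omega>) \<longlonglongrightarrow> 0"
  proof (rule tendstoI)
    fix e :: real assume "0 < e"
    \<comment> \<open>The mean of \<open>D n\<close> is split at height \<open>K\<close>. Below it,
      dominated convergence with a constant majorant applies; above it,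
      \<open>D \<le> D\<^sup>2 / K\<close>. Since the second moment of \<open>D n\<close> is at most
      \<open>4 * C\<close>, the second part is at most \<open>e / 2\<close>; the added 1 keeps
      \<open>K\<close> positive when \<open>C = 0\<close>.\<close>
    define K where "K = 8 * C / e + 1"
    have K: "0 < K" using C0 \<open>0 < e\<close> by (simp add: K_def add_nonneg_pos)
    have minint: "integrable M (\<lambda>\<omega>. min (D n \<omega>) K)" for n
      using D1[of n] by (intro integrable_min) auto
    have "(\<lambda>n. LINT \<omega>|M. min (D n \<omega>) K) \<longlonglongrightarrow> (LINT \<omega>|M. 0)"
    proof (rule integral_dominated_convergence[where w="\<lambda>_. K"])
      show "AE \<omega> in M. (\<lambda>n. min (D n \<omega>) K) \<longlonglongrightarrow> 0"
        using D0
      proof eventually_elim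
        case (elim \<omega>)
        then have "(\<lambda>n. min (D n \<omega>) K) \<longlonglongrightarrow> min 0 K" by (intro tendsto_intros)
        then show ?case using K by simp
      qed
      show "AE \<omega> in M. norm (min (D n \<omega>) K) \<le> K" for n
        using K by (auto simp: D_def)
    qed auto
    then have "\<forall>\<^sub>F n in sequentially. (LINT \<omega>|M. min (D n \<omega>) K) < e / 2"
      using \<open>0 < e\<close> by (intro order_tendstoD) auto
    then show "\<forall>\<^sub>F n in sequentially. dist (LINT \<omega>|M. D n \<omega>) 0 < e"
    proof eventually_elim
      case (elim n)
      have "D n \<omega> \<le> min (D n \<omega>) K + (D n \<omega>)\<^sup>2 / K" for \<omega>
      proof (cases "D n \<omega> \<le> K")
        case False
        then have "D n \<omega> * K \<le> (D n \<omega>)\<^sup>2"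
          using K by (simp add: power2_eq_square)
        then have "D n \<omega> \<le> (D n \<omega>)\<^sup>2 / K" using K by (simp add: field_simps)
        then show ?thesis using K False by simp
      qed (use K in auto)
      then have "(LINT \<omega>|M. D n \<omega>) \<le> (LINT \<omega>|M. min (D n \<omega>) K + (D n \<omega>)\<^sup>2 / K)"
        using D1 minint Dint2 by (intro integral_mono) auto
      also have "\<dots> = (LINT \<omega>|M. min (D n \<omega>) K) + (LINT \<omega>|M. (D n \<omega>)\<^sup>2) / K"
        using minint Dint2 by simp
      also have "\<dots> < e / 2 + 4 * C / K"
        using elim D2[of n] K by (intro add_less_le_mono divide_right_mono) auto
      also have "4 * C / K \<le> e / 2"
        using K \<open>0 < e\<close> by (simp add: K_def field_simps)
      finally have "(LINT \<omega>|M. D n \<omega>) < e" by simp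
      moreover have "0 \<le> (LINT \<omega>|M. D n \<omega>)" by (simp add: D_def)
      ultimately show ?case by (simp add: dist_real_def)
    qed
  qed
  then show "(\<lambda>n. LINT \<omega>|M. X n \<omega>) \<longlonglongrightarrow> (LINT \<omega>|M. Y \<omega>)"
  proof (subst LIM_zero_iff[symmetric], rule Lim_null_comparison[rotated])
    show "\<forall>\<^sub>F n in sequentially. norm ((LINT \<omega>|M. X n \<omega>) - (LINT \<omega>|M. Y \<omega>)) \<le> (LINT \<omega>|M. D n \<omega>)"
      unfolding D_def using X1 Y1
      by (intro always_eventually allI)
         (simp flip: Bochner_Integration.integral_diff)
  qed
qed

text \<open>The summands are orthogonal martingale differences: \<open>\<phi> i\<close> is known at
  stage \<open>i\<close>, while \<open>\<zeta> i - 1\<close> is centred and independent of that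
  stage. Second moments therefore add up, and each is at most \<open>c\<close> because
  \<open>\<phi> i\<close> is bounded by 1.\<close>

lemma (in prob_space) multiplicative_martingale_transform:
  fixes G :: "nat \<Rightarrow> 'a measure" and \<phi> \<zeta> :: "nat \<Rightarrow> 'a \<Rightarrow> complex"
  assumes sub: "\<And>i. subalgebra M (G i)" and mono: "\<And>i. sets (G i) \<subseteq> sets (G (Suc i))"
    and \<phi>_meas: "\<And>i. \<phi> i \<in> borel_measurable (G i)"
    and \<phi>_bound: "\<And>i \<omega>. \<omega> \<in> space M \<Longrightarrow> norm (\<phi> i \<omega>) \<le> 1"
    and \<zeta>_meas: "\<And>i. \<zeta> i \<in> borel_measurable (G (Suc i))"
    and indep: "\<And>i X. X \<in> borel_measurable (G i) \<Longrightarrow> indep_var borel X borel (\<zeta> i)"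
    and \<zeta>_int: "\<And>i. integrable M (\<zeta> i)" and \<zeta>_mean: "\<And>i. expectation (\<zeta> i) = 1"
    and \<zeta>_int2: "\<And>i. integrable M (\<lambda>\<omega>. (norm (\<zeta> i \<omega>))\<^sup>2)"
    and \<zeta>_var: "\<And>i. expectation (\<lambda>\<omega>. (norm (\<zeta> i \<omega>))\<^sup>2) \<le> 1 + c"
  defines "N n \<omega> \<equiv> (\<Sum>i<n. \<phi> i \<omega> * (\<zeta> i \<omega> - 1))"
  shows "integrable M (N n)" "expectation (N n) = 0"
    and "integrable M (\<lambda>\<omega>. (norm (N n \<omega>))\<^sup>2)" "expectation (\<lambda>\<omega>. (norm (N n \<omega>))\<^sup>2) \<le> n * c"
proof -
  have fromG: "X \<in> borel_measurable M" if "X \<in> borel_measurable (G i)" for X :: "'a \<Rightarrow> complex" and i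
    using that sub measurable_from_subalg by blast
  have [measurable]: "\<phi> i \<in> borel_measurable M" "\<zeta> i \<in> borel_measurable M" for i
    using fromG \<phi>_meas \<zeta>_meas by blast+
  define \<xi> where "\<xi> i \<omega> = \<zeta> i \<omega> - 1" for i \<omega>
  have [measurable]: "\<xi> i \<in> borel_measurable M" for i unfolding \<xi>_def by measurable
  have \<xi>_int: "integrable M (\<xi> i)" "expectation (\<xi> i) = 0" for i
    unfolding \<xi>_def using \<zeta>_int \<zeta>_mean by (auto simp: prob_space)
  \<comment> \<open>With mean 1 for \<open>\<zeta> i\<close>, the expectation of the right-hand side
    is the second moment of \<open>\<zeta> i\<close> minus 1, hence at most
    \<open>c\<close>.\<close>
  have \<xi>_sq: "(norm (\<xi> i \<omega>))\<^sup>2 = (norm (\<zeta> i \<omega>))\<^sup>2 - 2 * Re (\<zeta> i \<omega>) + 1" for i \<omega>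
    unfolding \<xi>_def by (simp only: cmod_power2) (simp add: power2_eq_square algebra_simps)
  have \<xi>_int2: "integrable M (\<lambda>\<omega>. (norm (\<xi> i \<omega>))\<^sup>2)" for i
    unfolding \<xi>_sq using \<zeta>_int \<zeta>_int2 by auto
  have \<xi>_var: "expectation (\<lambda>\<omega>. (norm (\<xi> i \<omega>))\<^sup>2) \<le> c" for i
    unfolding \<xi>_sq using \<zeta>_int \<zeta>_int2 \<zeta>_mean \<zeta>_var[of i] by (simp add: prob_space)
  have prod: "integrable M (\<lambda>\<omega>. X \<omega> * \<xi> i \<omega>)" "expectation (\<lambda>\<omega>. X \<omega> * \<xi> i \<omega>) = 0"
    if X: "X \<in> borel_measurable (G i)" "integrable M X" for X i
  proof -
    have iv: "indep_var borel X borel (\<zeta> i)" using indep X by blast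
    have *: "(\<lambda>\<omega>. X \<omega> * \<xi> i \<omega>) = (\<lambda>\<omega>. X \<omega> * \<zeta> i \<omega> - X \<omega>)"
      by (auto simp: \<xi>_def algebra_simps)
    show "integrable M (\<lambda>\<omega>. X \<omega> * \<xi> i \<omega>)"
      unfolding * using indep_var_integrable[OF iv X(2) \<zeta>_int] X by simp
    show "expectation (\<lambda>\<omega>. X \<omega> * \<xi> i \<omega>) = 0"
      unfolding * using indep_var_integrable[OF iv X(2) \<zeta>_int] X
        indep_var_lebesgue_integral[OF iv X(2) \<zeta>_int] by (simp add: \<zeta>_mean)
  qed
  have \<phi>1: "integrable M (\<phi> i)" for i
    by (rule integrable_const_bound[where B=1]) (use \<phi>_bound in auto)
  have up: "measurable (G i) borel \<subseteq> measurable (G (Suc i)) (borel :: complex measure)" for i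
    using sub mono by (intro measurable_mono) (auto simp: subalgebra_def)
  have NSuc: "N (Suc n) = (\<lambda>\<omega>. N n \<omega> + \<phi> n \<omega> * \<xi> n \<omega>)" for n
    by (auto simp: N_def \<xi>_def)
  have N_meas: "N n \<in> borel_measurable (G n)" for n
  proof (induction n)
    case (Suc n)
    have "\<phi> n \<in> borel_measurable (G (Suc n))" "N n \<in> borel_measurable (G (Suc n))"
      using up[of n] Suc \<phi>_meas by blast+
    then show ?case unfolding NSuc \<xi>_def using \<zeta>_meas[of n] by measurable
  qed (simp add: N_def)
  have "integrable M (N n) \<and> expectation (N n) = 0 \<and>
      integrable M (\<lambda>\<omega>. (norm (N n \<omega>))\<^sup>2) \<and> expectation (\<lambda>\<omega>. (norm (N n \<omega>))\<^sup>2) \<le> n * c"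
  proof (induction n)
    case (Suc n)
    then have IH: "integrable M (N n)" "expectation (N n) = 0" "integrable M (\<lambda>\<omega>. (norm (N n \<omega>))\<^sup>2)"
      "expectation (\<lambda>\<omega>. (norm (N n \<omega>))\<^sup>2) \<le> n * c" by auto
    note [measurable] = fromG[OF N_meas]
    note d = prod[OF \<phi>_meas \<phi>1]
    \<comment> \<open>The cross term of the square is twice the real part of
      \<open>?H * \<xi> n\<close>. As \<open>?H\<close> is measurable for \<open>G n\<close> and
      integrable, the same independence argument makes its mean zero.\<close>
    let ?H = "\<lambda>\<omega>. cnj (N n \<omega>) * \<phi> n \<omega>"
    have H: "?H \<in> borel_measurable (G n)"
      by (intro borel_measurable_times \<phi>_meas measurable_compose[OF N_meas]
          borel_measurable_continuous_onI continuous_intros)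
    have H1: "integrable M ?H"
      by (rule Bochner_Integration.integrable_bound[OF IH(1)])
         (use \<phi>_bound[of _ n] fromG[OF H] in \<open>auto intro!: AE_I2 mult_left_le simp: norm_mult\<close>)
    note cross = prod[OF H H1]
    define r where "r \<omega> = Re (cnj (N n \<omega>) * \<phi> n \<omega> * \<xi> n \<omega>)" for \<omega>
    have r: "integrable M r" "expectation r = 0"
      using cross unfolding r_def by (auto simp del: times_complex.sel)
    have sq: "(norm (N (Suc n) \<omega>))\<^sup>2 = (norm (N n \<omega>))\<^sup>2 + (norm (\<phi> n \<omega> * \<xi> n \<omega>))\<^sup>2
        + 2 * r \<omega>" for \<omega>
      unfolding NSuc r_def by (simp only: cmod_power2) (simp add: power2_eq_square algebra_simps)
    have le: "(norm (\<phi> n \<omega> * \<xi> n \<omega>))\<^sup>2 \<le> (norm (\<xi> n \<omega>))\<^sup>2" if "\<omega> \<in> space M" for \<omega>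
      using \<phi>_bound[OF that, of n] by (intro power_mono) (auto simp: norm_mult mult_left_le_one_le)
    have d2: "integrable M (\<lambda>\<omega>. (norm (\<phi> n \<omega> * \<xi> n \<omega>))\<^sup>2)"
      by (rule Bochner_Integration.integrable_bound[OF \<xi>_int2[of n]]) (use le in auto)
    have "expectation (\<lambda>\<omega>. (norm (\<phi> n \<omega> * \<xi> n \<omega>))\<^sup>2) \<le> expectation (\<lambda>\<omega>. (norm (\<xi> n \<omega>))\<^sup>2)"
      using d2 \<xi>_int2 le by (intro integral_mono) auto
    also note \<xi>_var
    finally have dvar: "expectation (\<lambda>\<omega>. (norm (\<phi> n \<omega> * \<xi> n \<omega>))\<^sup>2) \<le> c" .
    have "expectation (\<lambda>\<omega>. (norm (N (Suc n) \<omega>))\<^sup>2) = expectation (\<lambda>\<omega>. (norm (N n \<omega>))\<^sup>2)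
        + expectation (\<lambda>\<omega>. (norm (\<phi> n \<omega> * \<xi> n \<omega>))\<^sup>2)"
      unfolding sq using IH d2 r by simp
    then have "expectation (\<lambda>\<omega>. (norm (N (Suc n) \<omega>))\<^sup>2) \<le> Suc n * c"
      using IH dvar by (simp add: algebra_simps)
    moreover have "integrable M (\<lambda>\<omega>. (norm (N (Suc n) \<omega>))\<^sup>2)"
      unfolding sq using IH d2 r by simp
    ultimately show ?case using IH d unfolding NSuc by simp
  qed (simp add: N_def)
  then show "integrable M (N n)" "expectation (N n) = 0"
    and "integrable M (\<lambda>\<omega>. (norm (N n \<omega>))\<^sup>2)" "expectation (\<lambda>\<omega>. (norm (N n \<omega>))\<^sup>2) \<le> n * c"
    by auto
qed

section \<open>Integrals along random distribution functions\<close>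

text \<open>A common interface for Lebesgue measure and Stieltjes measures, so that
  \<open>dt\<close> and the boundary integrals share one theory. The negative axis is left free, as
  Lebesgue measure charges it; the absence of an atom at 0 lets \<open>{0..}\<close> and
  \<open>{0<..}\<close> be exchanged.\<close>

definition has_distribution_fun :: "real measure \<Rightarrow> (real \<Rightarrow> real) \<Rightarrow> bool" where
  "has_distribution_fun N l \<longleftrightarrow>
     sets N = sets borel \<and> emeasure N {0} = 0 \<and> mono_on {0..} l \<and>
     (\<forall>a b. 0 \<le> a \<longrightarrow> a \<le> b \<longrightarrow> emeasure N {a<..b} = ennreal (l b - l a))"

lemma has_distribution_fun_lborel: "has_distribution_fun lborel (\<lambda>t. t)"
  by (auto simp: has_distribution_fun_def mono_on_def)

lemma has_distribution_fun_stieltjes: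
  assumes "mono_on {0..} l" "continuous_on {0..} l"
  shows "has_distribution_fun (stieltjes l) l"
proof -
  have mono: "l (max 0 s) \<le> l (max 0 t)" if "s \<le> t" for s t
    using that by (intro mono_onD[OF assms(1)]) auto
  have cont: "continuous_on UNIV (\<lambda>t. l (max 0 t))"
    by (rule continuous_on_compose2[OF assms(2)]) (auto intro!: continuous_intros)
  then have "continuous (at_right a) (\<lambda>t. l (max 0 t))" for a
    by (auto intro: continuous_within_subset simp: continuous_on_eq_continuous_within)
  then have "emeasure (stieltjes l) {a<..b} = ennreal (l b - l a)" if "0 \<le> a" "a \<le> b" for a b
    using that mono unfolding stieltjes_def by (subst emeasure_interval_measure_Ioc) auto
  moreover have "emeasure (stieltjes l) {0} = 0"
    using emeasure_interval_measure_Icc[of 0 0 "\<lambda>t. l (max 0 t)"] mono cont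
    by (simp add: stieltjes_def)
  ultimately show ?thesis
    using assms(1) by (simp add: has_distribution_fun_def stieltjes_def)
qed

section \<open>Riemann sums over uniform partitions\<close>

definition grid :: "real \<Rightarrow> nat \<Rightarrow> nat \<Rightarrow> real" where
  "grid T n i = T * real i / real n"

text \<open>The integrand is sampled at the right end of each cell: this is where summation by parts
  of a product of a martingale and a finite variation path leaves the martingale factor.\<close>

definition riemann_sum :: "(real \<Rightarrow> real) \<Rightarrow> (real \<Rightarrow> 'b::real_vector) \<Rightarrow> real \<Rightarrow> nat \<Rightarrow> 'b" where
  "riemann_sum l g T n = (\<Sum>i<n. (l (grid T n (Suc i)) - l (grid T n i)) *\<^sub>R g (grid T n (Suc i)))"

lemma grid_simps [simp]: "grid T n 0 = 0" "0 < n \<Longrightarrow> grid T n n = T"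
  by (simp_all add: grid_def)

lemma grid_step: "grid T n (Suc i) - grid T n i = T / n"
  by (simp add: grid_def flip: diff_divide_distrib) (simp add: algebra_simps)

lemma grid_mono: "0 \<le> T \<Longrightarrow> i \<le> j \<Longrightarrow> grid T n i \<le> grid T n j"
  by (auto simp: grid_def intro!: divide_right_mono mult_left_mono)

lemma grid_nonneg [simp]: "0 \<le> T \<Longrightarrow> 0 \<le> grid T n i"
  by (simp add: grid_def)

lemma grid_le: "0 \<le> T \<Longrightarrow> i \<le> n \<Longrightarrow> grid T n i \<le> T"
  by (cases "n = 0") (use grid_mono[of T i n n] in auto)

lemma grid_cell:
  assumes "0 < T" "0 < n" "0 < t" "t \<le> T"
  obtains j where "j < n" "grid T n j < t" "t \<le> grid T n (Suc j)"
proof -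
  define j where "j = (LEAST j. t \<le> grid T n (Suc j))"
  have ex: "t \<le> grid T n (Suc (n - 1))" using assms by simp
  have le: "t \<le> grid T n (Suc j)" unfolding j_def using ex by (rule LeastI)
  have "j \<le> n - 1" unfolding j_def using ex by (rule Least_le)
  moreover have "grid T n j < t"
  proof (cases j)
    case (Suc i)
    then show ?thesis using not_less_Least[of i "\<lambda>j. t \<le> grid T n (Suc j)"] by (auto simp: j_def)
  qed (use assms in auto)
  ultimately show thesis using that[of j] le assms by auto
qed

lemma has_distribution_fun_integrable:
  fixes g :: "real \<Rightarrow> 'b::{banach, second_countable_topology}"
  assumes N: "has_distribution_fun N l" and "0 \<le> T" and cont: "continuous_on {0..T} g"
  shows "set_integrable N {0<..T} g"
proof -
  have sets[measurable_cong]: "sets N = sets borel" using N by (simp add: has_distribution_fun_def)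
  obtain B where B: "\<And>t. t \<in> {0..T} \<Longrightarrow> norm (g t) \<le> B"
    using compact_imp_bounded[OF compact_continuous_image[OF cont compact_Icc]]
    unfolding bounded_iff by blast
  have "set_borel_measurable borel {0<..T} g"
    using cont by (intro set_measurable_continuous_on) (auto intro: continuous_on_subset)
  then have m: "(\<lambda>t. indicator {0<..T} t *\<^sub>R g t) \<in> borel_measurable N"
    by (simp add: set_borel_measurable_def cong: measurable_cong_sets)
  show ?thesis
    unfolding set_integrable_def
  proof (rule Bochner_Integration.integrable_bound[OF _ m])
    show "integrable N (\<lambda>t. indicator {0<..T} t *\<^sub>R B)"
      using N \<open>0 \<le> T\<close> by (intro integrable_scaleR_left integrable_real_indicator)
        (auto simp: has_distribution_fun_def)
    show "AE t in N. norm (indicator {0<..T} t *\<^sub>R g t) \<le> norm (indicator {0<..T} t *\<^sub>R B)"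
      using B by (intro AE_I2) (auto simp: indicator_def intro: order_trans[OF _ abs_ge_self])
  qed
qed

text \<open>The Riemann sum is the integral of a step function \<open>s n\<close>, whose value at
  \<open>t\<close> is that of \<open>g\<close> at the right end of the cell containing
  \<open>t\<close>, at distance at most \<open>T / n\<close>. Continuity gives pointwise convergence
  and boundedness of \<open>g\<close> on the compact interval gives a majorant.\<close>

lemma riemann_sum_tendsto:
  fixes g :: "real \<Rightarrow> 'b::{banach, second_countable_topology}"
  assumes N: "has_distribution_fun N l" and T: "0 < T" and cont: "continuous_on {0..T} g"
  shows "(\<lambda>n. riemann_sum l g T n) \<longlonglongrightarrow> (LINT t:{0<..T}|N. g t)"
proof -
  have sets[measurable_cong]: "sets N = sets borel" using N by (simp add: has_distribution_fun_def)
  have em: "emeasure N {a<..b} = ennreal (l b - l a)" if "0 \<le> a" "a \<le> b" for a b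
    using N that by (simp add: has_distribution_fun_def)
  have mono: "l a \<le> l b" if "0 \<le> a" "a \<le> b" for a b
    using N that by (auto simp: has_distribution_fun_def mono_on_def)
  define s where "s n t = (\<Sum>i<n. indicator {grid T n i<..grid T n (Suc i)} t *\<^sub>R g (grid T n (Suc i)))"
    for n t
  have s_in: "\<exists>r. r \<in> {0..T} \<and> \<bar>r - t\<bar> \<le> T / n \<and> s n t = g r" if pos: "0 < n" "0 < t" "t \<le> T" for n t
  proof -
    obtain j where j: "j < n" "grid T n j < t" "t \<le> grid T n (Suc j)"
      by (rule grid_cell[OF T pos])
    have "t \<notin> {grid T n i<..grid T n (Suc i)}" if "i \<noteq> j" for i
    proof (cases "i < j")
      case True
      then show ?thesis using grid_mono[of T "Suc i" j n] j T by auto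
    next
      case False
      then show ?thesis using that grid_mono[of T "Suc j" i n] j T by auto
    qed
    then have "s n t = (\<Sum>i<n. if i = j then g (grid T n (Suc j)) else 0)"
      unfolding s_def using j by (intro sum.cong) (auto simp: indicator_def)
    also have "\<dots> = g (grid T n (Suc j))" using j by simp
    finally show ?thesis
      using j grid_step[of T n j] grid_le[of T "Suc j" n] T
      by (intro exI[of _ "grid T n (Suc j)"]) auto
  qed
  have s_out: "s n t = 0" if "t \<notin> {0<..T}" for n t
    unfolding s_def
  proof (rule sum.neutral, safe)
    fix i assume "i < n"
    then have "{grid T n i<..grid T n (Suc i)} \<subseteq> {0<..T}"
      using grid_le[of T "Suc i" n] grid_nonneg[of T n i] T by (auto simp del: grid_nonneg)
    then show "indicator {grid T n i<..grid T n (Suc i)} t *\<^sub>R g (grid T n (Suc i)) = 0"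
      using that by (auto simp: indicator_def)
  qed
  obtain B where B: "\<And>t. t \<in> {0..T} \<Longrightarrow> norm (g t) \<le> B"
    using compact_imp_bounded[OF compact_continuous_image[OF cont compact_Icc]]
    unfolding bounded_iff by blast
  have s_meas [measurable]: "s n \<in> borel_measurable N" for n
    unfolding s_def by measurable
  have "(\<lambda>n. LINT t|N. s n t) \<longlonglongrightarrow> (LINT t|N. indicator {0<..T} t *\<^sub>R g t)"
  proof (rule integral_dominated_convergence[where w="\<lambda>t. indicator {0<..T} t *\<^sub>R B"])
    show "(\<lambda>t. indicator {0<..T} t *\<^sub>R g t) \<in> borel_measurable N"
      using has_distribution_fun_integrable[OF N _ cont] T
      by (auto simp: set_integrable_def)
    show "integrable N (\<lambda>t. indicator {0<..T} t *\<^sub>R B)"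
      using em[of 0 T] T by (intro integrable_scaleR_left integrable_real_indicator) auto
    show "AE t in N. norm (s n t) \<le> indicator {0<..T} t *\<^sub>R B" for n
    proof (intro AE_I2)
      fix t
      show "norm (s n t) \<le> indicator {0<..T} t *\<^sub>R B"
      proof (cases "n = 0 \<or> t \<notin> {0<..T}")
        case True
        moreover have "0 \<le> B" using order_trans[OF norm_ge_zero B[of 0]] T by simp
        ultimately show ?thesis using s_out[of t n]
          by (auto simp: s_def indicator_def)
      next
        case False
        then show ?thesis using s_in[of n t] B by auto
      qed
    qed
    show "AE t in N. (\<lambda>n. s n t) \<longlonglongrightarrow> indicator {0<..T} t *\<^sub>R g t"
    proof (intro AE_I2)
      fix t
      show "(\<lambda>n. s n t) \<longlonglongrightarrow> indicator {0<..T} t *\<^sub>R g t"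
      proof (cases "t \<in> {0<..T}")
        case True
        show ?thesis
        proof (rule tendstoI)
          fix e :: real assume "0 < e"
          then obtain d where d: "d > 0" "\<And>r. r \<in> {0..T} \<Longrightarrow> dist r t < d \<Longrightarrow> dist (g r) (g t) < e"
            using cont[unfolded continuous_on_iff, rule_format, of t e] True by auto
          have "(\<lambda>n. T / real n) \<longlonglongrightarrow> 0" by (rule lim_const_over_n)
          then have "\<forall>\<^sub>F n in sequentially. T / n < d" using d by (intro order_tendstoD)
          with eventually_gt_at_top[of 0]
          show "\<forall>\<^sub>F n in sequentially. dist (s n t) (indicator {0<..T} t *\<^sub>R g t) < e"
          proof eventually_elim
            case (elim n)
            obtain r where "r \<in> {0..T}" "\<bar>r - t\<bar> \<le> T / n" "s n t = g r"
              using s_in[of n t] elim True by auto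
            then show ?case using d(2)[of r] elim True by (auto simp: dist_real_def)
          qed
        qed
      qed (simp add: s_out)
    qed
  qed auto
  moreover have "(LINT t|N. s n t) = riemann_sum l g T n" for n
  proof -
    have int: "integrable N (\<lambda>t. indicator {grid T n i<..grid T n (Suc i)} t *\<^sub>R g (grid T n (Suc i)))" for i
      using em grid_mono[of T i "Suc i" n] T by (intro integrable_scaleR_left integrable_real_indicator) auto
    have "measure N {grid T n i<..grid T n (Suc i)} = l (grid T n (Suc i)) - l (grid T n i)" for i
      using em grid_mono[of T i "Suc i" n] T mono by (simp add: measure_def)
    moreover have "integrable N (indicator {grid T n i<..grid T n (Suc i)} :: real \<Rightarrow> real)" for i
      using em grid_mono[of T i "Suc i" n] T by (intro integrable_real_indicator) auto
    ultimately have "(LINT t|N. indicator {grid T n i<..grid T n (Suc i)} t *\<^sub>R g (grid T n (Suc i)))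
        = (l (grid T n (Suc i)) - l (grid T n i)) *\<^sub>R g (grid T n (Suc i))" for i
      by (simp add: sets)
    then show ?thesis
      unfolding s_def riemann_sum_def using int by (subst Bochner_Integration.integral_sum) auto
  qed
  ultimately show ?thesis by (simp add: set_lebesgue_integral_def)
qed

text \<open>The error \<open>1 - exp (- d) - d\<close> is of second order in \<open>d\<close>. A sum
  of squared increments is at most the largest increment times the total variation; the former
  vanishes with the mesh by uniform continuity, and \<open>m\<close> controls the latter.\<close>

lemma exp_increment_sum_tendsto:
  fixes f :: "real \<Rightarrow> complex" and c :: "nat \<Rightarrow> nat \<Rightarrow> complex"
  assumes T: "0 < T" and cont: "continuous_on {0..T} f"
    and var: "\<And>s t. 0 \<le> s \<Longrightarrow> s \<le> t \<Longrightarrow> t \<le> T \<Longrightarrow> norm (f t - f s) \<le> m t - m s"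
    and c: "\<And>n i. i < n \<Longrightarrow> norm (c n i) \<le> 1"
  shows "(\<lambda>n. (\<Sum>i<n. c n i * (1 - exp (- (f (grid T n (Suc i)) - f (grid T n i)))))
      - (\<Sum>i<n. c n i * (f (grid T n (Suc i)) - f (grid T n i)))) \<longlonglongrightarrow> 0"
proof (rule tendstoI)
  fix e :: real assume e: "0 < e"
  have m0: "0 \<le> m T - m 0"
    by (rule order_trans[OF norm_ge_zero[of "f T - f 0"] var]) (use T in auto)
  \<comment> \<open>The cap 1 keeps the exponential in the Taylor remainder below 3, and the
    quotient makes the total error smaller than \<open>e\<close>. The summand 3 in the denominator
    covers the case of zero variation.\<close>
  define \<eta> where "\<eta> = min 1 (e / (3 * (m T - m 0) + 3))"
  have \<eta>: "0 < \<eta>" "\<eta> \<le> 1" "3 * \<eta> * (m T - m 0) < e"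
  proof -
    show "0 < \<eta>" "\<eta> \<le> 1" using e m0 by (auto simp: \<eta>_def)
    have "3 * \<eta> * (m T - m 0) \<le> 3 * (e / (3 * (m T - m 0) + 3)) * (m T - m 0)"
      using m0 by (intro mult_right_mono) (auto simp: \<eta>_def)
    also have "\<dots> < e" using e m0 by (simp add: field_simps)
    finally show "3 * \<eta> * (m T - m 0) < e" .
  qed
  have "uniformly_continuous_on {0..T} f" using cont by (intro compact_uniformly_continuous) auto
  then obtain d where d: "d > 0" "\<And>s t. s \<in> {0..T} \<Longrightarrow> t \<in> {0..T} \<Longrightarrow> dist t s < d \<Longrightarrow> dist (f t) (f s) < \<eta>"
    using \<eta>(1) unfolding uniformly_continuous_on_def by blast
  have "(\<lambda>n. T / real n) \<longlonglongrightarrow> 0" by (rule lim_const_over_n)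
  then have "\<forall>\<^sub>F n in sequentially. T / n < d" using d by (intro order_tendstoD)
  with eventually_gt_at_top[of 0]
  show "\<forall>\<^sub>F n in sequentially. dist ((\<Sum>i<n. c n i * (1 - exp (- (f (grid T n (Suc i)) - f (grid T n i)))))
      - (\<Sum>i<n. c n i * (f (grid T n (Suc i)) - f (grid T n i)))) 0 < e"
  proof eventually_elim
    case (elim n)
    define \<Delta> where "\<Delta> i = f (grid T n (Suc i)) - f (grid T n i)" for i
    have summand: "norm (c n i * (1 - exp (- \<Delta> i)) - c n i * \<Delta> i)
        \<le> 3 * \<eta> * (m (grid T n (Suc i)) - m (grid T n i))" if "i < n" for i
    proof -
      have small: "norm (\<Delta> i) \<le> \<eta>"
        using d(2)[of "grid T n i" "grid T n (Suc i)"] elim T that grid_le[of T "Suc i" n] grid_le[of T i n]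
          grid_step[of T n i] by (auto simp: \<Delta>_def dist_norm)
      have "norm (exp (- \<Delta> i) - (1 - \<Delta> i)) \<le> exp \<bar>Re (- \<Delta> i)\<bar> * norm (\<Delta> i) ^ 2"
        using Taylor_exp[of "- \<Delta> i" 1] by (simp add: numeral_2_eq_2)
      also have "\<dots> \<le> exp 1 * norm (\<Delta> i) ^ 2"
        using abs_Re_le_cmod[of "\<Delta> i"] small \<eta> by (intro mult_right_mono) auto
      also have "\<dots> \<le> 3 * norm (\<Delta> i) ^ 2"
        using exp_le by (intro mult_right_mono) auto
      also have "\<dots> \<le> 3 * (\<eta> * norm (\<Delta> i))"
        using small by (auto simp: power2_eq_square intro!: mult_right_mono)
      also have "\<dots> \<le> 3 * (\<eta> * (m (grid T n (Suc i)) - m (grid T n i)))"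
        unfolding \<Delta>_def using \<eta> T that grid_le[of T "Suc i" n] grid_mono[of T i "Suc i" n]
        by (intro mult_left_mono var) auto
      finally have *: "norm (exp (- \<Delta> i) - (1 - \<Delta> i)) \<le> 3 * \<eta> * (m (grid T n (Suc i)) - m (grid T n i))"
        by simp
      have "norm (c n i * (1 - exp (- \<Delta> i)) - c n i * \<Delta> i) = norm (c n i) * norm (exp (- \<Delta> i) - (1 - \<Delta> i))"
        unfolding norm_mult[symmetric] by (subst norm_minus_cancel[symmetric]) (simp add: algebra_simps)
      also have "\<dots> \<le> 1 * norm (exp (- \<Delta> i) - (1 - \<Delta> i))"
        using c[OF that] by (intro mult_right_mono) auto
      finally show ?thesis using * by simp
    qed
    have "norm ((\<Sum>i<n. c n i * (1 - exp (- \<Delta> i))) - (\<Sum>i<n. c n i * \<Delta> i))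
        \<le> (\<Sum>i<n. 3 * \<eta> * (m (grid T n (Suc i)) - m (grid T n i)))"
      unfolding sum_subtractf[symmetric] using summand by (intro sum_norm_le) auto
    also have "\<dots> = 3 * \<eta> * (m T - m 0)"
      using sum_lessThan_telescope[of "\<lambda>i. m (grid T n i)" n] elim
      by (simp flip: sum_distrib_left)
    finally show ?case using \<eta>(3) by (simp add: \<Delta>_def dist_norm)
  qed
qed

section \<open>Passage from bounded intervals to the half line\<close>

text \<open>Monotone convergence along the intervals from 0 to \<open>Suc k\<close>, which are
  nondegenerate for every \<open>k\<close>. The missing endpoint 0 is a null point.\<close>

lemma nn_integral_half_line:
  assumes N: "has_distribution_fun N l" and cont: "continuous_on {0..} h" and nonneg: "\<And>t. 0 \<le> t \<Longrightarrow> 0 \<le> h t"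
  shows "(\<integral>\<^sup>+t\<in>{0..}. ennreal (h t) \<partial>N) = (\<Squnion>k. ennreal (LINT t:{0<..real (Suc k)}|N. h t))"
proof -
  have sets[measurable_cong]: "sets N = sets borel" using N by (simp add: has_distribution_fun_def)
  \<comment> \<open>Multiplying by the indicator extends \<open>h\<close> by zero, as its continuity
    and sign are known only on the half line.\<close>
  have [measurable]: "(\<lambda>t. indicator {0<..} t * h t) \<in> borel_measurable N"
  proof -
    have "continuous_on {0<..} h" by (rule continuous_on_subset[OF cont]) auto
    then show ?thesis
      using set_measurable_continuous_on[of "{0<..}" h]
      by (auto simp: set_borel_measurable_def sets cong: measurable_cong_sets)
  qed
  have ne0: "AE t in N. t \<noteq> 0"
    using N by (intro AE_I[of _ _ "{0}"]) (auto simp: has_distribution_fun_def)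
  have fin: "ennreal (LINT t:{0<..real (Suc k)}|N. h t)
      = (\<integral>\<^sup>+t. ennreal (indicator {0<..} t * h t) * indicator {0<..real (Suc k)} t \<partial>N)" for k
  proof -
    have "set_integrable N {0<..real (Suc k)} h"
      by (rule has_distribution_fun_integrable[OF N]) (auto intro: continuous_on_subset[OF cont])
    then have "ennreal (LINT t:{0<..real (Suc k)}|N. h t)
        = (\<integral>\<^sup>+t. ennreal (indicator {0<..real (Suc k)} t *\<^sub>R h t) \<partial>N)"
      unfolding set_integrable_def set_lebesgue_integral_def using nonneg
      by (subst nn_integral_eq_integral) (auto simp: indicator_def)
    also have "\<dots> = (\<integral>\<^sup>+t. ennreal (indicator {0<..} t * h t) * indicator {0<..real (Suc k)} t \<partial>N)"
      by (intro nn_integral_cong) (auto simp: indicator_def)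
    finally show ?thesis .
  qed
  have inc: "incseq (\<lambda>k t. ennreal (indicator {0<..} t * h t) * indicator {0<..real (Suc k)} t)"
    by (intro incseq_SucI le_funI) (auto simp: indicator_def)
  have "(\<integral>\<^sup>+t\<in>{0..}. ennreal (h t) \<partial>N) = (\<integral>\<^sup>+t. ennreal (indicator {0<..} t * h t) \<partial>N)"
    using ne0 by (intro nn_integral_cong_AE) (auto elim!: eventually_mono simp: indicator_def)
  also have "\<dots> = (\<integral>\<^sup>+t. (\<Squnion>k. ennreal (indicator {0<..} t * h t) * indicator {0<..real (Suc k)} t) \<partial>N)"
  proof (intro nn_integral_cong)
    fix t
    show "ennreal (indicator {0<..} t * h t) = (\<Squnion>k. ennreal (indicator {0<..} t * h t) * indicator {0<..real (Suc k)} t)"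
    proof (cases "0 < t")
      case True
      obtain k where k: "t \<le> real k" using real_arch_simple by blast
      show ?thesis
      proof (rule antisym)
        show "ennreal (indicator {0<..} t * h t) \<le> (\<Squnion>k. ennreal (indicator {0<..} t * h t) * indicator {0<..real (Suc k)} t)"
          using True k by (intro SUP_upper2[of k]) auto
        show "(\<Squnion>k. ennreal (indicator {0<..} t * h t) * indicator {0<..real (Suc k)} t) \<le> ennreal (indicator {0<..} t * h t)"
          by (intro SUP_least) (auto simp: indicator_def)
      qed
    qed auto
  qed
  also have "\<dots> = (\<Squnion>k. \<integral>\<^sup>+t. ennreal (indicator {0<..} t * h t) * indicator {0<..real (Suc k)} t \<partial>N)"
    using inc by (rule nn_integral_monotone_convergence_SUP) measurable
  finally show ?thesis by (simp only: fin)
qed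

lemma set_integrable_half_line:
  fixes g :: "real \<Rightarrow> 'b::{banach, second_countable_topology}"
  assumes N: "has_distribution_fun N l" and cont: "continuous_on {0..} g"
    and fin: "(\<integral>\<^sup>+t\<in>{0..}. ennreal (norm (g t)) \<partial>N) < \<infinity>"
  shows "set_integrable N {0..} g"
    and "(\<lambda>k. LINT t:{0<..real (Suc k)}|N. g t) \<longlonglongrightarrow> (LINT t:{0..}|N. g t)"
proof -
  have sets[measurable_cong]: "sets N = sets borel" using N by (simp add: has_distribution_fun_def)
  have m: "(\<lambda>t. indicator A t *\<^sub>R g t) \<in> borel_measurable N" if "A \<subseteq> {0..}" "A \<in> sets borel" for A
    using set_measurable_continuous_on[OF that(2), of g] cont that
    by (auto simp: set_borel_measurable_def sets cong: measurable_cong_sets intro: continuous_on_subset)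
  have ne0: "AE t in N. t \<noteq> 0"
    using N by (intro AE_I[of _ _ "{0}"]) (auto simp: has_distribution_fun_def)
  show *: "set_integrable N {0..} g"
    unfolding set_integrable_def
  proof (rule integrableI_bounded[OF m])
    have "(\<integral>\<^sup>+ t. ennreal (norm (indicator {0..} t *\<^sub>R g t)) \<partial>N) = (\<integral>\<^sup>+t\<in>{0..}. ennreal (norm (g t)) \<partial>N)"
      by (intro nn_integral_cong) (auto simp: indicator_def)
    with fin show "(\<integral>\<^sup>+ t. ennreal (norm (indicator {0..} t *\<^sub>R g t)) \<partial>N) < \<infinity>" by simp
  qed auto
  show "(\<lambda>k. LINT t:{0<..real (Suc k)}|N. g t) \<longlonglongrightarrow> (LINT t:{0..}|N. g t)"
    unfolding set_lebesgue_integral_def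
  proof (rule integral_dominated_convergence[where w="\<lambda>t. norm (indicator {0..} t *\<^sub>R g t)"])
    show "integrable N (\<lambda>t. norm (indicator {0..} t *\<^sub>R g t))"
      by (rule integrable_norm[OF *[unfolded set_integrable_def]])
    show "AE t in N. (\<lambda>k. indicator {0<..real (Suc k)} t *\<^sub>R g t) \<longlonglongrightarrow> indicator {0..} t *\<^sub>R g t"
      using ne0
    proof eventually_elim
      case (elim t)
      have "\<forall>\<^sub>F k in sequentially. t \<le> real (Suc k)"
        using eventually_ge_at_top[of "nat \<lceil>t\<rceil>"] by eventually_elim linarith
      then have "\<forall>\<^sub>F k in sequentially. indicator {0<..real (Suc k)} t *\<^sub>R g t = indicator {0..} t *\<^sub>R g t"
        by eventually_elim (use elim in \<open>auto simp: indicator_def\<close>)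
      then show ?case by (rule tendsto_eventually)
    qed
    show "AE t in N. norm (indicator {0<..real (Suc k)} t *\<^sub>R g t) \<le> norm (indicator {0..} t *\<^sub>R g t)" for k
      by (intro AE_I2) (auto simp: indicator_def)
  qed (auto intro!: m)
qed

section \<open>Random measures and path expectations\<close>

text \<open>Measurability is asked only of the distribution function at fixed times. That of
  integrals against the random measure is recovered from limits of Riemann sums.\<close>

locale random_distribution = prob_space M for M :: "'a measure" +
  fixes N :: "'a \<Rightarrow> real measure" and l :: "'a \<Rightarrow> real \<Rightarrow> real"
  assumes distribution: "\<omega> \<in> space M \<Longrightarrow> has_distribution_fun (N \<omega>) (l \<omega>)"
    and meas_l: "0 \<le> t \<Longrightarrow> (\<lambda>\<omega>. l \<omega> t) \<in> borel_measurable M"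
begin

text \<open>Neither \<open>N\<close> nor \<open>l\<close> occurs in the body, so the property is the
  same for every random measure over \<open>M\<close>, and one verification serves all three
  integrators.\<close>

definition continuous_integrand :: "('a \<Rightarrow> real \<Rightarrow> 'b::{banach, second_countable_topology}) \<Rightarrow> bool" where
  "continuous_integrand g \<longleftrightarrow>
     (\<forall>\<omega>\<in>space M. continuous_on {0..} (g \<omega>)) \<and> (\<forall>t\<ge>0. (\<lambda>\<omega>. g \<omega> t) \<in> borel_measurable M)"

lemma continuous_integrand_norm:
  "continuous_integrand g \<Longrightarrow> continuous_integrand (\<lambda>\<omega> t. norm (g \<omega> t))"
  by (auto simp: continuous_integrand_def intro: continuous_intros)

lemma measurable_riemann_sum:
  "continuous_integrand g \<Longrightarrow> 0 \<le> T \<Longrightarrow> (\<lambda>\<omega>. riemann_sum (l \<omega>) (g \<omega>) T n) \<in> borel_measurable M"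
  unfolding riemann_sum_def continuous_integrand_def
  by (intro borel_measurable_sum borel_measurable_scaleR borel_measurable_diff meas_l) auto

lemma riemann_sum_tendsto_path:
  assumes "continuous_integrand g" "0 < T" "\<omega> \<in> space M"
  shows "(\<lambda>n. riemann_sum (l \<omega>) (g \<omega>) T n) \<longlonglongrightarrow> (LINT t:{0<..T}|N \<omega>. g \<omega> t)"
  using assms unfolding continuous_integrand_def
  by (intro riemann_sum_tendsto distribution) (auto intro: continuous_on_subset)

lemma measurable_integral_Ioc:
  assumes g: "continuous_integrand g" and T: "0 < T"
  shows "(\<lambda>\<omega>. LINT t:{0<..T}|N \<omega>. g \<omega> t) \<in> borel_measurable M"
  by (rule borel_measurable_LIMSEQ_metric[OF measurable_riemann_sum[OF g less_imp_le[OF T]]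
        riemann_sum_tendsto_path[OF g T]])

lemma nn_integral_path:
  assumes h: "continuous_integrand h" and nonneg: "\<And>\<omega> t. \<omega> \<in> space M \<Longrightarrow> 0 \<le> t \<Longrightarrow> (0::real) \<le> h \<omega> t"
    and "\<omega> \<in> space M"
  shows "(\<integral>\<^sup>+t\<in>{0..}. ennreal (h \<omega> t) \<partial>N \<omega>) = (\<Squnion>k. ennreal (LINT t:{0<..real (Suc k)}|N \<omega>. h \<omega> t))"
  using assms by (intro nn_integral_half_line[OF distribution]) (auto simp: continuous_integrand_def)

lemma measurable_nn_integral_path:
  assumes h: "continuous_integrand h" and nonneg: "\<And>\<omega> t. \<omega> \<in> space M \<Longrightarrow> 0 \<le> t \<Longrightarrow> (0::real) \<le> h \<omega> t"
  shows "(\<lambda>\<omega>. \<integral>\<^sup>+t\<in>{0..}. ennreal (h \<omega> t) \<partial>N \<omega>) \<in> borel_measurable M"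
  by (subst measurable_cong[OF nn_integral_path[OF h nonneg]])
     (auto intro!: borel_measurable_SUP measurable_compose[OF measurable_integral_Ioc[OF h]])

text \<open>Where the integral converges absolutely it is the limit of integrals over bounded
  intervals. Elsewhere the Bochner integral is 0 by convention, so the approximating sequence is set
  to 0 on the measurable event where \<open>Q\<close> is infinite.\<close>

lemma measurable_path_integral:
  fixes g :: "'a \<Rightarrow> real \<Rightarrow> 'b::{banach, second_countable_topology}"
  assumes g: "continuous_integrand g"
  shows "(\<lambda>\<omega>. LINT t:{0..}|N \<omega>. g \<omega> t) \<in> borel_measurable M"
proof -
  define Q where "Q \<omega> = (\<integral>\<^sup>+t\<in>{0..}. ennreal (norm (g \<omega> t)) \<partial>N \<omega>)" for \<omega>
  have [measurable]: "Q \<in> borel_measurable M"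
    unfolding Q_def by (rule measurable_nn_integral_path[OF continuous_integrand_norm[OF g]]) auto
  have I[measurable]: "(\<lambda>\<omega>. LINT t:{0<..real (Suc k)}|N \<omega>. g \<omega> t) \<in> borel_measurable M" for k
    by (rule measurable_integral_Ioc[OF g]) simp
  show ?thesis
  proof (rule borel_measurable_LIMSEQ_metric)
    show "(\<lambda>\<omega>. if Q \<omega> < \<infinity> then LINT t:{0<..real (Suc k)}|N \<omega>. g \<omega> t else 0) \<in> borel_measurable M" for k
      by measurable
    show "(\<lambda>k. if Q \<omega> < \<infinity> then LINT t:{0<..real (Suc k)}|N \<omega>. g \<omega> t else 0) \<longlonglongrightarrow> (LINT t:{0..}|N \<omega>. g \<omega> t)"
      if \<omega>: "\<omega> \<in> space M" for \<omega>
    proof (cases "Q \<omega> < \<infinity>")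
      case True
      then show ?thesis
        using set_integrable_half_line(2)[OF distribution[OF \<omega>], of "g \<omega>"] g \<omega>
        by (simp add: Q_def continuous_integrand_def)
    next
      case False
      have "Q \<omega> = (\<integral>\<^sup>+ t. ennreal (norm (indicator {0..} t *\<^sub>R g \<omega> t)) \<partial>N \<omega>)"
        unfolding Q_def by (intro nn_integral_cong) (auto simp: indicator_def)
      with False have "\<not> set_integrable (N \<omega>) {0..} (g \<omega>)"
        by (auto simp: set_integrable_def integrable_iff_bounded)
      then have "(LINT t:{0..}|N \<omega>. g \<omega> t) = 0"
        by (simp add: set_integrable_def set_lebesgue_integral_def not_integrable_integral_eq)
      with False show ?thesis by simp
    qed
  qed
qed

text \<open>Fatou's lemma in the mesh, then monotone convergence in the horizon: a bound on the
  Riemann sums that is uniform in both carries over to the whole half line.\<close>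

lemma nn_integral_path_le:
  assumes h: "continuous_integrand h" and nonneg: "\<And>\<omega> t. \<omega> \<in> space M \<Longrightarrow> 0 \<le> t \<Longrightarrow> (0::real) \<le> h \<omega> t"
    and bound: "\<And>T n. 0 < T \<Longrightarrow> (\<integral>\<^sup>+\<omega>. ennreal (riemann_sum (l \<omega>) (h \<omega>) T n) \<partial>M) \<le> C"
  shows "(\<integral>\<^sup>+\<omega>. (\<integral>\<^sup>+t\<in>{0..}. ennreal (h \<omega> t) \<partial>N \<omega>) \<partial>M) \<le> C"
proof -
  define G where "G k \<omega> = ennreal (LINT t:{0<..real (Suc k)}|N \<omega>. h \<omega> t)" for k \<omega>
  have G_meas [measurable]: "G k \<in> borel_measurable M" for k
    unfolding G_def by (intro measurable_compose[OF measurable_integral_Ioc[OF h]]) auto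
  have G_le: "(\<integral>\<^sup>+\<omega>. G k \<omega> \<partial>M) \<le> C" for k
  proof -
    have "(\<integral>\<^sup>+\<omega>. G k \<omega> \<partial>M) = (\<integral>\<^sup>+\<omega>. liminf (\<lambda>n. ennreal (riemann_sum (l \<omega>) (h \<omega>) (real (Suc k)) n)) \<partial>M)"
    proof (intro nn_integral_cong)
      fix \<omega> assume "\<omega> \<in> space M"
      then have "(\<lambda>n. ennreal (riemann_sum (l \<omega>) (h \<omega>) (real (Suc k)) n)) \<longlonglongrightarrow> G k \<omega>"
        unfolding G_def by (intro tendsto_ennrealI riemann_sum_tendsto_path[OF h]) auto
      then show "G k \<omega> = liminf (\<lambda>n. ennreal (riemann_sum (l \<omega>) (h \<omega>) (real (Suc k)) n))"
        by (metis lim_imp_Liminf sequentially_bot)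
    qed
    also have "\<dots> \<le> liminf (\<lambda>n. \<integral>\<^sup>+\<omega>. ennreal (riemann_sum (l \<omega>) (h \<omega>) (real (Suc k)) n) \<partial>M)"
      by (intro nn_integral_liminf measurable_compose[OF measurable_riemann_sum[OF h]]) auto
    also have "\<dots> \<le> liminf (\<lambda>n::nat. C)"
      by (intro Liminf_mono always_eventually allI bound) simp
    finally show ?thesis by (simp add: Liminf_const)
  qed
  have inc: "G i \<omega> \<le> G j \<omega>" if "\<omega> \<in> space M" "i \<le> j" for i j \<omega>
  proof -
    have "set_integrable (N \<omega>) {0<..real (Suc k)} (h \<omega>)" for k
      using that h unfolding continuous_integrand_def
      by (intro has_distribution_fun_integrable[OF distribution]) (auto intro: continuous_on_subset)
    then show ?thesis
      unfolding G_def set_lebesgue_integral_def set_integrable_def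
      using that nonneg by (intro ennreal_leI integral_mono) (auto simp: indicator_def)
  qed
  have "(\<integral>\<^sup>+\<omega>. (\<integral>\<^sup>+t\<in>{0..}. ennreal (h \<omega> t) \<partial>N \<omega>) \<partial>M) = (\<integral>\<^sup>+\<omega>. (\<Squnion>k. G k \<omega>) \<partial>M)"
    unfolding G_def by (intro nn_integral_cong nn_integral_path[OF h nonneg])
  also have "\<dots> = (\<Squnion>k. \<integral>\<^sup>+\<omega>. G k \<omega> \<partial>M)"
    using inc by (intro nn_integral_monotone_convergence_SUP_AE) auto
  also have "\<dots> \<le> C" using G_le by (intro SUP_least) auto
  finally show ?thesis .
qed

text \<open>The total absolute integral \<open>Q\<close> of a path serves as integrable majorant for
  all truncated integrals. Domination by \<open>h\<close> is asked only almost everywhere for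
  \<open>N \<omega>\<close>, so a comparison valid only on the boundary suffices for integrals along
  the boundary processes.\<close>

lemma path_expectation_dominated:
  fixes g :: "'a \<Rightarrow> real \<Rightarrow> complex"
  assumes g: "continuous_integrand g"
    and le: "\<And>\<omega>. \<omega> \<in> space M \<Longrightarrow> AE t in N \<omega>. 0 \<le> t \<longrightarrow> norm (g \<omega> t) \<le> h \<omega> t"
    and fin: "(\<integral>\<^sup>+\<omega>. (\<integral>\<^sup>+t\<in>{0..}. ennreal (h \<omega> t) \<partial>N \<omega>) \<partial>M) < \<infinity>"
  shows "path_expectation_exists M N g"
    and "\<And>k. integrable M (\<lambda>\<omega>. LINT t:{0<..real (Suc k)}|N \<omega>. g \<omega> t)"
    and "(\<lambda>k. LINT \<omega>|M. (LINT t:{0<..real (Suc k)}|N \<omega>. g \<omega> t)) \<longlonglongrightarrow> path_expectation M N g"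
proof -
  define Q where "Q \<omega> = (\<integral>\<^sup>+t\<in>{0..}. ennreal (norm (g \<omega> t)) \<partial>N \<omega>)" for \<omega>
  have Q_meas [measurable]: "Q \<in> borel_measurable M"
    unfolding Q_def by (rule measurable_nn_integral_path[OF continuous_integrand_norm[OF g]]) auto
  have "(\<integral>\<^sup>+\<omega>. Q \<omega> \<partial>M) \<le> (\<integral>\<^sup>+\<omega>. (\<integral>\<^sup>+t\<in>{0..}. ennreal (h \<omega> t) \<partial>N \<omega>) \<partial>M)"
  proof (rule nn_integral_mono)
    fix \<omega> assume "\<omega> \<in> space M"
    from le[OF this] show "Q \<omega> \<le> (\<integral>\<^sup>+t\<in>{0..}. ennreal (h \<omega> t) \<partial>N \<omega>)"
      unfolding Q_def by (intro nn_integral_mono_AE) (auto elim!: eventually_mono simp: indicator_def ennreal_leI)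
  qed
  then have Q_fin: "(\<integral>\<^sup>+\<omega>. Q \<omega> \<partial>M) < \<infinity>" using fin by (rule le_less_trans)
  then have "AE \<omega> in M. Q \<omega> \<noteq> \<infinity>" by (intro nn_integral_PInf_AE) auto
  then have Q_AE: "AE \<omega> in M. \<omega> \<in> space M \<and> Q \<omega> < \<infinity>" by (auto simp: top.not_eq_extremum)
  have Qint: "integrable M (\<lambda>\<omega>. enn2real (Q \<omega>))"
  proof (rule integrableI_bounded)
    have "(\<integral>\<^sup>+\<omega>. ennreal (norm (enn2real (Q \<omega>))) \<partial>M) \<le> (\<integral>\<^sup>+\<omega>. Q \<omega> \<partial>M)"
      by (intro nn_integral_mono) (auto simp: ennreal_enn2real_if)
    then show "(\<integral>\<^sup>+\<omega>. ennreal (norm (enn2real (Q \<omega>))) \<partial>M) < \<infinity>" using Q_fin by (rule le_less_trans)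
  qed auto
  have AE_lim: "AE \<omega> in M. set_integrable (N \<omega>) {0..} (g \<omega>) \<and>
      (\<lambda>k. LINT t:{0<..real (Suc k)}|N \<omega>. g \<omega> t) \<longlonglongrightarrow> (LINT t:{0..}|N \<omega>. g \<omega> t)"
    using Q_AE
  proof eventually_elim
    case (elim \<omega>)
    then show ?case
      using set_integrable_half_line[OF distribution, of \<omega> "g \<omega>"] g
      by (auto simp: Q_def continuous_integrand_def)
  qed
  \<comment> \<open>If the integral over \<open>A\<close> does not exist it is 0 by convention, and
    the bound is trivial.\<close>
  have Jle: "norm (LINT t:A|N \<omega>. g \<omega> t) \<le> enn2real (Q \<omega>)"
    if "\<omega> \<in> space M" "Q \<omega> < \<infinity>" "A \<subseteq> {0..}" for \<omega> A
  proof -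
    have "ennreal (norm (LINT t:A|N \<omega>. g \<omega> t)) \<le> (\<integral>\<^sup>+ t. ennreal (norm (indicator A t *\<^sub>R g \<omega> t)) \<partial>N \<omega>)"
      unfolding set_lebesgue_integral_def
      by (cases "integrable (N \<omega>) (\<lambda>t. indicator A t *\<^sub>R g \<omega> t)")
         (auto intro: integral_norm_bound_ennreal simp: not_integrable_integral_eq simp del: norm_scaleR)
    also have "\<dots> \<le> Q \<omega>"
      unfolding Q_def using that(3) by (intro nn_integral_mono) (auto simp: indicator_def)
    finally show ?thesis using that(2) by (auto dest: enn2real_mono)
  qed
  have I_meas: "(\<lambda>\<omega>. LINT t:{0<..real (Suc k)}|N \<omega>. g \<omega> t) \<in> borel_measurable M" for k
    by (rule measurable_integral_Ioc[OF g]) simp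
  have bound: "AE \<omega> in M. norm (LINT t:{0<..real (Suc k)}|N \<omega>. g \<omega> t) \<le> enn2real (Q \<omega>)" for k
    using Q_AE by eventually_elim (auto intro!: Jle)
  have lim: "AE \<omega> in M. (\<lambda>k. LINT t:{0<..real (Suc k)}|N \<omega>. g \<omega> t) \<longlonglongrightarrow> (LINT t:{0..}|N \<omega>. g \<omega> t)"
    using AE_lim by eventually_elim simp
  note dct = measurable_path_integral[OF g] I_meas Qint lim bound
  show "path_expectation_exists M N g"
    unfolding path_expectation_exists_def
    using AE_lim integrable_dominated_convergence[OF dct] by (auto elim: eventually_mono)
  show "integrable M (\<lambda>\<omega>. LINT t:{0<..real (Suc k)}|N \<omega>. g \<omega> t)" for k
    by (rule integrable_dominated_convergence2[OF dct])
  show "(\<lambda>k. LINT \<omega>|M. (LINT t:{0<..real (Suc k)}|N \<omega>. g \<omega> t)) \<longlonglongrightarrow> path_expectation M N g"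
    unfolding path_expectation_def by (rule integral_dominated_convergence[OF dct])
qed

end

section \<open>Exponential functionals of the reflected process\<close>

lemma inner_real2: "v \<bullet> w = v $ 1 * w $ 1 + v $ 2 * w $ (2::2)" for v w :: "real^2"
  by (simp add: inner_vec_def sum_2)

lemma cov_matrix_inner:
  "v \<bullet> (cov_matrix \<rho> *v w) = v $ 1 * w $ 1 + v $ 2 * w $ 2 + \<rho> * (v $ 1 * w $ 2 + v $ 2 * w $ 1)"
  by (simp add: inner_real2 cov_matrix_def matrix_vector_mult_def sum_2 algebra_simps)

text \<open>The matrix is diagonal along (1, 1) and (1, -1), with eigenvalues
  \<open>1 + \<rho>\<close> and \<open>1 - \<rho>\<close>.\<close>

lemma cov_matrix_pos:
  assumes "-1 < \<rho>" "\<rho> < 1" "v \<noteq> 0"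
  shows "0 < v \<bullet> (cov_matrix \<rho> *v v)"
proof -
  have eq: "2 * (v \<bullet> (cov_matrix \<rho> *v v)) = (1 + \<rho>) * (v $ 1 + v $ 2)\<^sup>2 + (1 - \<rho>) * (v $ 1 - v $ 2)\<^sup>2"
    by (simp add: cov_matrix_inner power2_eq_square algebra_simps)
  have "v $ 1 + v $ 2 \<noteq> 0 \<or> v $ 1 - v $ 2 \<noteq> 0"
    using assms(3) by (auto simp: vec_eq_iff forall_2)
  then have "0 < (1 + \<rho>) * (v $ 1 + v $ 2)\<^sup>2 + (1 - \<rho>) * (v $ 1 - v $ 2)\<^sup>2"
    using assms(1,2) by (auto intro: add_pos_nonneg add_nonneg_pos)
  then show ?thesis using eq by linarith
qed

lemma exp_minus_one_le: "exp z - 1 \<le> z * exp z" for z :: real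
proof -
  have "(1 - z) * exp z \<le> exp (- z) * exp z"
    using exp_ge_add_one_self[of "- z"] by (intro mult_right_mono) auto
  then show ?thesis by (simp add: algebra_simps flip: exp_add)
qed

text \<open>The two last inequalities pair a positive vector with the columns of the reflection
  matrix. This is how the existence condition enters the proof.\<close>

lemma exists_inward_direction:
  fixes r1 r2 :: real
  assumes "1 - r1 * r2 > 0 \<or> (r1 > 0 \<and> r2 > 0)"
  obtains v1 v2 :: real where "0 < v1" "0 < v2" "0 < v1 + r1 * v2" "0 < r2 * v1 + v2"
proof (cases "0 \<le> r1")
  case True
  show thesis
    \<comment> \<open>The maximum makes \<open>r2 * v1 + v2\<close> at least 1, and being positive
      it does no harm to \<open>v1 + r1 * v2\<close>.\<close>
    using True by (intro that[of 1 "max 1 (1 - r2)"]) (auto simp: max_def add_pos_nonneg)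
next
  case r1: False
  then have prod: "r1 * r2 < 1" using assms by auto
  show thesis
  proof (cases "0 \<le> r2")
    case True
    then show thesis using r1 by (intro that[of "1 - r1" 1]) (auto simp: add_nonneg_pos)
  next
    case False
    \<comment> \<open>With \<open>v1 = 1\<close> the admissible values of \<open>v2\<close> lie
      strictly between \<open>- r2\<close> and \<open>1 / (- r1)\<close>. This interval is nonempty
      because \<open>r1 * r2 < 1\<close>, and \<open>v\<close> is its midpoint.\<close>
    define v where "v = (- r2 + 1 / (- r1)) / 2"
    have "- r2 < 1 / (- r1)" using prod r1 by (simp add: field_simps)
    then have "- r2 < v" "v < 1 / (- r1)" by (auto simp: v_def)
    then show thesis using r1 False by (intro that[of 1 v]) (auto simp: field_simps)
  qed
qed

section \<open>Paths of the planar reflected process\<close>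

locale planar_srbm =
  fixes M :: "'a measure" and F :: "real \<Rightarrow> 'a measure"
    and Z B L :: "real \<Rightarrow> 'a \<Rightarrow> real^2"
    and z0 \<mu> :: "real^2" and \<rho> r1 r2 :: real
  assumes rho: "-1 < \<rho>" "\<rho> < 1"
    and srbm: "srbm M F (cov_matrix \<rho>) \<mu> (refl_matrix r1 r2) z0 Z B L"
begin

sublocale prob_space M
  using srbm by (simp add: srbm_def filtered_prob_space_def)

lemma subalgebra_F: "subalgebra M (F t)"
  using srbm by (simp add: srbm_def filtered_prob_space_def)

lemma sets_F_mono: "s \<le> t \<Longrightarrow> sets (F s) \<subseteq> sets (F t)"
  using srbm filtration.sets_F_mono[of "space M" F s t] by (auto simp: srbm_def filtered_prob_space_def)

lemma measurable_F_mono: "f \<in> measurable (F s) N \<Longrightarrow> s \<le> t \<Longrightarrow> f \<in> measurable (F t) N"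
  using sets_F_mono[of s t] subalgebra_F[of s] subalgebra_F[of t]
  by (auto simp: measurable_def subalgebra_def)

lemma measurable_F: "f \<in> measurable (F s) N \<Longrightarrow> f \<in> measurable M N"
  using measurable_from_subalg[OF subalgebra_F] .

lemma adapted:
  assumes "0 \<le> t"
  shows "Z t \<in> borel_measurable (F t)" "B t \<in> borel_measurable (F t)" "L t \<in> borel_measurable (F t)"
  using srbm assms
  by (auto simp: srbm_def markov_process_def brownian_motion_def adapted_process_def)

lemma measurable_component: "X \<in> borel_measurable N \<Longrightarrow> (\<lambda>\<omega>. X \<omega> $ i) \<in> borel_measurable N"
  for X :: "'a \<Rightarrow> real^2"
  by (rule measurable_compose[OF _ borel_measurable_continuous_onI]) (auto intro: continuous_intros)

lemma continuous_path:
  assumes "\<omega> \<in> space M"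
  shows "continuous_on {0..} (\<lambda>t. Z t \<omega> $ i)" "continuous_on {0..} (\<lambda>t. L t \<omega> $ i)"
proof -
  have "continuous_on {0..} (\<lambda>t. Z t \<omega>)" "continuous_on {0..} (\<lambda>t. L t \<omega>)"
    using srbm assms by (auto simp: srbm_def continuous_paths_def)
  then show "continuous_on {0..} (\<lambda>t. Z t \<omega> $ i)" "continuous_on {0..} (\<lambda>t. L t \<omega> $ i)"
    by (simp_all add: continuous_on_component)
qed

lemma Z_nonneg: "\<omega> \<in> space M \<Longrightarrow> 0 \<le> t \<Longrightarrow> 0 \<le> Z t \<omega> $ i"
  using srbm by (auto simp: srbm_def)

lemma decomposition:
  assumes "\<omega> \<in> space M" "0 \<le> t"
  shows "Z t \<omega> $ 1 = z0 $ 1 + B t \<omega> $ 1 + t * \<mu> $ 1 + L t \<omega> $ 1 + r2 * L t \<omega> $ 2"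
    and "Z t \<omega> $ 2 = z0 $ 2 + B t \<omega> $ 2 + t * \<mu> $ 2 + r1 * L t \<omega> $ 1 + L t \<omega> $ 2"
proof -
  have "Z t \<omega> = z0 + B t \<omega> + t *\<^sub>R \<mu> + refl_matrix r1 r2 *v L t \<omega>"
    using srbm assms by (auto simp: srbm_def)
  then show "Z t \<omega> $ 1 = z0 $ 1 + B t \<omega> $ 1 + t * \<mu> $ 1 + L t \<omega> $ 1 + r2 * L t \<omega> $ 2"
    "Z t \<omega> $ 2 = z0 $ 2 + B t \<omega> $ 2 + t * \<mu> $ 2 + r1 * L t \<omega> $ 1 + L t \<omega> $ 2"
    by (simp_all add: refl_matrix_def matrix_vector_mult_def sum_2)
qed

lemma initial: "\<omega> \<in> space M \<Longrightarrow> B 0 \<omega> = 0" "\<omega> \<in> space M \<Longrightarrow> L 0 \<omega> = 0" "\<omega> \<in> space M \<Longrightarrow> Z 0 \<omega> = z0"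
proof -
  show B0: "B 0 \<omega> = 0" if "\<omega> \<in> space M" for \<omega>
    using srbm that by (auto simp: srbm_def brownian_motion_def)
  show L0: "L 0 \<omega> = 0" if "\<omega> \<in> space M" for \<omega>
    using srbm that by (auto simp: srbm_def)
  show "Z 0 \<omega> = z0" if "\<omega> \<in> space M" for \<omega>
    using decomposition[OF that, of 0] B0[OF that] L0[OF that] by (simp add: vec_eq_iff forall_2)
qed

lemma L_mono: "\<omega> \<in> space M \<Longrightarrow> 0 \<le> s \<Longrightarrow> s \<le> t \<Longrightarrow> L s \<omega> $ i \<le> L t \<omega> $ i"
  using srbm by (auto simp: srbm_def mono_on_def)

lemma AE_boundary: "\<omega> \<in> space M \<Longrightarrow> AE t in stieltjes (\<lambda>s. L s \<omega> $ i). 0 \<le> t \<longrightarrow> Z t \<omega> $ i = 0"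
  using srbm by (auto simp: srbm_def)

lemma random_distribution_L:
  "random_distribution M (\<lambda>\<omega>. stieltjes (\<lambda>s. L s \<omega> $ i)) (\<lambda>\<omega> t. L t \<omega> $ i)"
proof (unfold_locales)
  show "has_distribution_fun (stieltjes (\<lambda>s. L s \<omega> $ i)) (\<lambda>t. L t \<omega> $ i)" if "\<omega> \<in> space M" for \<omega>
    using that L_mono continuous_path
    by (intro has_distribution_fun_stieltjes) (auto simp: mono_on_def)
  show "(\<lambda>\<omega>. L t \<omega> $ i) \<in> borel_measurable M" if "0 \<le> t" for t
    by (rule measurable_component[OF measurable_F[OF adapted(3)[OF that]]])
qed

text \<open>Elapsed time is treated as a third integrator beside the two boundary processes.\<close>

sublocale clock: random_distribution M "\<lambda>_. lborel" "\<lambda>_ t. t"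
  by unfold_locales (auto simp: has_distribution_fun_lborel)

sublocale L1: random_distribution M "\<lambda>\<omega>. stieltjes (\<lambda>s. L s \<omega> $ 1)" "\<lambda>\<omega> t. L t \<omega> $ 1"
  by (rule random_distribution_L)

sublocale L2: random_distribution M "\<lambda>\<omega>. stieltjes (\<lambda>s. L s \<omega> $ 2)" "\<lambda>\<omega> t. L t \<omega> $ 2"
  by (rule random_distribution_L)

lemma integrand_measurable: "0 \<le> t \<Longrightarrow> (\<lambda>\<omega>. integrand Z u x y \<omega> t) \<in> borel_measurable (F t)"
  unfolding integrand_def using measurable_component[OF adapted(1)[of t]] by measurable

lemma continuous_integrand_integrand: "clock.continuous_integrand (integrand Z u x y)"
  unfolding clock.continuous_integrand_def
proof (intro conjI ballI allI impI)
  show "continuous_on {0..} (integrand Z u x y \<omega>)" if "\<omega> \<in> space M" for \<omega>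
    unfolding integrand_def 
    by (intro continuous_on_exp continuous_on_add continuous_on_mult continuous_on_of_real
        continuous_on_const continuous_on_id continuous_path(1)[OF that])
qed (rule measurable_F[OF integrand_measurable])

lemma norm_integrand: "norm (integrand Z u x y \<omega> t) = exp (Re x * Z t \<omega> $ 1 + Re y * Z t \<omega> $ 2 + Re u * t)"
  by (simp add: integrand_def)

lemma norm_integrand_le_one:
  assumes "Re x \<le> 0" "Re y \<le> 0" "Re u \<le> 0" "\<omega> \<in> space M" "0 \<le> t"
  shows "norm (integrand Z u x y \<omega> t) \<le> 1"
  using assms Z_nonneg[of \<omega> t 1] Z_nonneg[of \<omega> t 2]
  by (auto simp: norm_integrand intro!: add_nonpos_nonpos mult_nonpos_nonneg)

section \<open>The exponential martingale of the Brownian part\<close>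

definition noise :: "complex \<Rightarrow> complex \<Rightarrow> real \<Rightarrow> 'a \<Rightarrow> complex" where
  "noise x y t \<omega> = x * of_real (B t \<omega> $ 1) + y * of_real (B t \<omega> $ 2)"

definition quad :: "complex \<Rightarrow> complex \<Rightarrow> complex" where
  "quad x y = x\<^sup>2 + y\<^sup>2 + 2 * of_real \<rho> * x * y"

text \<open>The ratio of the values of the exponential martingale at times \<open>t\<close> and
  \<open>s\<close>. Unlike the martingale itself, it is independent of the past up to
  \<open>s\<close>.\<close>

definition exp_increment :: "complex \<Rightarrow> complex \<Rightarrow> real \<Rightarrow> real \<Rightarrow> 'a \<Rightarrow> complex" where
  "exp_increment x y s t \<omega> = exp (noise x y t \<omega> - noise x y s \<omega> - quad x y * of_real (t - s) / 2)"

text \<open>The exponential growth rate of the second moment of that ratio: the covariance form at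
  the real parts of (x, y) plus the form at the imaginary parts.\<close>

definition variance_rate :: "complex \<Rightarrow> complex \<Rightarrow> real" where
  "variance_rate x y = (Re x)\<^sup>2 + (Re y)\<^sup>2 + 2 * \<rho> * Re x * Re y + ((Im x)\<^sup>2 + (Im y)\<^sup>2 + 2 * \<rho> * Im x * Im y)"

lemma variance_rate_nonneg: "0 \<le> variance_rate x y"
proof -
  have "0 \<le> v \<bullet> (cov_matrix \<rho> *v v)" for v :: "real^2"
    using cov_matrix_pos[OF rho, of v] by (cases "v = 0") auto
  from this[of "vector [Re x, Re y]"] this[of "vector [Im x, Im y]"] show ?thesis
    by (simp add: variance_rate_def cov_matrix_inner power2_eq_square algebra_simps)
qed

text \<open>With \<open>a\<close> and \<open>b\<close> the real and imaginary parts of (x, y), the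
  noise increment is \<open>a \<bullet> X \<omega> + \<i> * (b \<bullet> X \<omega>)\<close>. The
  mean is then the complex Gaussian moment at \<open>z = \<i>\<close>, and the second moment is the
  real one in direction \<open>2 *\<^sub>R a\<close>.\<close>

lemma
  assumes "0 \<le> s" "s < t"
  shows integrable_exp_increment: "integrable M (exp_increment x y s t)"
    and expectation_exp_increment: "expectation (exp_increment x y s t) = 1"
    and integrable_exp_increment_sq: "integrable M (\<lambda>\<omega>. (norm (exp_increment x y s t \<omega>))\<^sup>2)"
    and expectation_exp_increment_sq:
      "expectation (\<lambda>\<omega>. (norm (exp_increment x y s t \<omega>))\<^sup>2) = exp (variance_rate x y * (t - s))"
proof -
  define X where "X \<omega> = B t \<omega> - B s \<omega>" for \<omega>
  define C where "C = (t - s) *\<^sub>R cov_matrix \<rho>"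
  have gauss: "centred_gaussian M C X"
    using srbm assms by (auto simp: srbm_def brownian_motion_def X_def[abs_def] C_def)
  have X_meas: "X \<in> borel_measurable M"
    unfolding X_def using assms by (intro borel_measurable_diff measurable_F[OF adapted(2)]) auto
  have C_inner: "v \<bullet> (C *v w) = (t - s) * (v \<bullet> (cov_matrix \<rho> *v w))" for v w
    by (simp add: C_def scaleR_matrix_vector_assoc[symmetric])
  have pos: "\<forall>v. v \<noteq> 0 \<longrightarrow> 0 < v \<bullet> (C *v v)"
    using cov_matrix_pos[OF rho] assms by (simp add: C_inner)
  define a :: "real^2" where "a = vector [Re x, Re y]"
  define b :: "real^2" where "b = vector [Im x, Im y]"
  define k where "k = exp (- quad x y * of_real (t - s) / 2)"
  have eq: "exp_increment x y s t = (\<lambda>\<omega>. exp (of_real (a \<bullet> X \<omega>) + \<i> * of_real (b \<bullet> X \<omega>)) * k)"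
  proof
    fix \<omega>
    have "noise x y t \<omega> - noise x y s \<omega> = of_real (a \<bullet> X \<omega>) + \<i> * of_real (b \<bullet> X \<omega>)"
      by (simp add: complex_eq_iff noise_def inner_real2 a_def b_def X_def algebra_simps)
    then show "exp_increment x y s t \<omega> = exp (of_real (a \<bullet> X \<omega>) + \<i> * of_real (b \<bullet> X \<omega>)) * k"
      by (simp add: exp_increment_def k_def flip: exp_add)
  qed
  note moment = centred_gaussian_exp_moment[OF X_meas gauss pos, of a \<i> b]
  show "integrable M (exp_increment x y s t)"
    unfolding eq using moment by simp
  have "of_real (a \<bullet> (C *v a)) + \<i> * of_real (a \<bullet> (C *v b) + b \<bullet> (C *v a)) + \<i>\<^sup>2 * of_real (b \<bullet> (C *v b))
      = quad x y * of_real (t - s)"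
    unfolding C_inner cov_matrix_inner a_def b_def quad_def
    by (simp add: complex_eq_iff power2_eq_square algebra_simps)
  then have "expectation (\<lambda>\<omega>. exp (of_real (a \<bullet> X \<omega>) + \<i> * of_real (b \<bullet> X \<omega>)))
      = exp (quad x y * of_real (t - s) / 2)"
    using moment(2) by (simp only:)
  moreover have "exp (quad x y * of_real (t - s) / 2) * k = 1"
    unfolding k_def by (simp flip: exp_add)
  ultimately show "expectation (exp_increment x y s t) = 1"
    unfolding eq by (simp only: integral_mult_left_zero)
  have sq: "(norm (exp_increment x y s t \<omega>))\<^sup>2 = exp ((2 *\<^sub>R a) \<bullet> X \<omega>) * exp (- Re (quad x y) * (t - s))" for \<omega>
    unfolding eq k_def norm_mult by (simp add: power_mult_distrib flip: exp_of_nat_mult exp_add)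
  note moment2 = centred_gaussian_real_exp_moment[OF gauss pos, of "2 *\<^sub>R a"]
  show "integrable M (\<lambda>\<omega>. (norm (exp_increment x y s t \<omega>))\<^sup>2)"
    unfolding sq using moment2 by simp
  \<comment> \<open>Per unit time the doubled direction contributes twice the covariance form at
    \<open>a\<close>. Subtracting the real part of \<open>quad x y\<close>, the form at
    \<open>a\<close> minus the form at \<open>b\<close>, leaves the sum of the two forms.\<close>
  have "(2 *\<^sub>R a) \<bullet> (C *v (2 *\<^sub>R a)) / 2 + - Re (quad x y) * (t - s) = variance_rate x y * (t - s)"
    unfolding C_inner cov_matrix_inner a_def variance_rate_def quad_def
    by (simp add: power2_eq_square field_simps)
  then have "exp ((2 *\<^sub>R a) \<bullet> (C *v (2 *\<^sub>R a)) / 2) * exp (- Re (quad x y) * (t - s)) = exp (variance_rate x y * (t - s))"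
    by (simp only: exp_add[symmetric])
  then show "expectation (\<lambda>\<omega>. (norm (exp_increment x y s t \<omega>))\<^sup>2) = exp (variance_rate x y * (t - s))"
    unfolding sq by (simp only: integral_mult_left_zero moment2(2))
qed

lemma exp_increment_measurable:
  assumes "0 \<le> s" "s \<le> t"
  shows "exp_increment x y s t \<in> borel_measurable (F t)"
proof -
  have [measurable]: "B s \<in> borel_measurable (F t)" "B t \<in> borel_measurable (F t)"
    by (rule measurable_F_mono[OF adapted(2)], use assms in simp_all)+
  note [measurable] = measurable_component
  show ?thesis unfolding exp_increment_def noise_def by measurable
qed

text \<open>The ratio is a function of the Brownian increment alone, so its sigma-algebra lies
  inside the one that is independent of \<open>F s\<close>.\<close>

lemma exp_increment_indep:
  fixes X :: "'a \<Rightarrow> complex"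
  assumes "0 \<le> s" "s < t" and X: "X \<in> borel_measurable (F s)"
  shows "indep_var borel X borel (exp_increment x y s t)"
proof -
  let ?V = "vimage_algebra (space M) (\<lambda>\<omega>. B t \<omega> - B s \<omega>) borel"
  have indep: "indep_set (sets (F s)) (sets ?V)"
    using srbm assms by (auto simp: srbm_def brownian_motion_def)
  have V: "(\<lambda>\<omega>. B t \<omega> - B s \<omega>) \<in> borel_measurable ?V"
    by (rule measurable_vimage_algebra1) auto
  have eq: "exp_increment x y s t \<omega> = exp (x * of_real ((B t \<omega> - B s \<omega>) $ 1) + y * of_real ((B t \<omega> - B s \<omega>) $ 2)
      - quad x y * of_real (t - s) / 2)" for \<omega>
    by (simp add: exp_increment_def noise_def algebra_simps)
  have Y: "exp_increment x y s t \<in> borel_measurable ?V"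
    unfolding eq using measurable_component[OF V] by measurable
  show ?thesis
    unfolding indep_var_eq
  proof (intro conjI)
    show "random_variable borel X" by (rule measurable_F[OF X])
    show "random_variable borel (exp_increment x y s t)"
      using exp_increment_measurable[of s t x y] assms by (auto intro: measurable_F)
    have sp: "space (F s) = space M" "space ?V = space M"
      using subalgebra_F by (auto simp: subalgebra_def)
    have "{X -` A \<inter> space M |A. A \<in> sets borel} \<subseteq> sets (F s)"
      using measurable_sets[OF X] sp by auto
    from sets.sigma_sets_subset[OF this]
    have "sigma_sets (space M) {X -` A \<inter> space M |A. A \<in> sets borel} \<subseteq> sets (F s)"
      by (simp only: sp)
    moreover have "{exp_increment x y s t -` A \<inter> space M |A. A \<in> sets borel} \<subseteq> sets ?V"
      using measurable_sets[OF Y] sp by auto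
    from sets.sigma_sets_subset[OF this]
    have "sigma_sets (space M) {exp_increment x y s t -` A \<inter> space M |A. A \<in> sets borel} \<subseteq> sets ?V"
      by (simp only: sp)
    ultimately show "indep_set (sigma_sets (space M) {X -` A \<inter> space M |A. A \<in> sets borel})
        (sigma_sets (space M) {exp_increment x y s t -` A \<inter> space M |A. A \<in> sets borel})"
      using indep unfolding indep_set_def
      by (elim indep_sets_mono_sets) (auto split: bool.splits)
  qed
qed

section \<open>Factorisation of the integrand and summation by parts\<close>

definition drift_part :: "complex \<Rightarrow> complex \<Rightarrow> complex \<Rightarrow> real \<Rightarrow> 'a \<Rightarrow> complex" where
  "drift_part u x y t \<omega> = (kernel_K \<rho> \<mu> x y + u) * of_real t
     + kernel_k1 r1 x y * of_real (L t \<omega> $ 1) + kernel_k2 r2 x y * of_real (L t \<omega> $ 2)"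

text \<open>The kernel contains \<open>quad x y / 2\<close>, which offsets the compensator of the
  martingale; the columns of the reflection matrix produce \<open>k1\<close> and
  \<open>k2\<close>.\<close>

lemma integrand_decomposition:
  assumes "\<omega> \<in> space M" "0 \<le> t"
  shows "integrand Z u x y \<omega> t = exp (x * of_real (z0 $ 1) + y * of_real (z0 $ 2) + noise x y t \<omega>
    - quad x y * of_real t / 2 + drift_part u x y t \<omega>)"
proof -
  have "x * of_real (Z t \<omega> $ 1) + y * of_real (Z t \<omega> $ 2) + u * of_real t =
    x * of_real (z0 $ 1) + y * of_real (z0 $ 2) + noise x y t \<omega>
    - quad x y * of_real t / 2 + drift_part u x y t \<omega>"
    unfolding decomposition[OF assms] noise_def drift_part_def quad_def kernel_K_def kernel_k1_def kernel_k2_def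
    by (simp add: field_simps)
  then show ?thesis by (simp only: integrand_def)
qed

text \<open>In the factorisation \<open>exp Y = N V\<close> of the introduction, \<open>V\<^sub>t = exp (Y\<^sub>0 + drift_part t)\<close>; with
  \<open>s < t\<close> consecutive grid points, the summand is \<open>N\<^sub>t (V\<^sub>t - V\<^sub>s)\<close>, and \<open>N\<close> moves by the factor
  \<open>exp_increment s t\<close>.\<close>

definition stieltjes_sum :: "complex \<Rightarrow> complex \<Rightarrow> complex \<Rightarrow> real \<Rightarrow> nat \<Rightarrow> 'a \<Rightarrow> complex" where
  "stieltjes_sum u x y T n \<omega> = (\<Sum>i<n. integrand Z u x y \<omega> (grid T n (Suc i)) *
     (1 - exp (- (drift_part u x y (grid T n (Suc i)) \<omega> - drift_part u x y (grid T n i) \<omega>))))"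

text \<open>Removing the drift accumulated over a cell from the right-end value leaves the left-end
  value times the martingale ratio. The differences of end values telescope, and the remainder is a
  martingale transform with coefficients taken at left ends.\<close>

lemma stieltjes_sum_eq:
  assumes "\<omega> \<in> space M" "0 < T" "0 < n"
  shows "stieltjes_sum u x y T n \<omega> = integrand Z u x y \<omega> T - integrand Z u x y \<omega> 0 -
    (\<Sum>i<n. integrand Z u x y \<omega> (grid T n i) * (exp_increment x y (grid T n i) (grid T n (Suc i)) \<omega> - 1))"
proof -
  let ?e = "\<lambda>i. integrand Z u x y \<omega> (grid T n i)"
  let ?\<zeta> = "\<lambda>i. exp_increment x y (grid T n i) (grid T n (Suc i)) \<omega>"
  have "?e (Suc i) * (1 - exp (- (drift_part u x y (grid T n (Suc i)) \<omega> - drift_part u x y (grid T n i) \<omega>)))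
      = (?e (Suc i) - ?e i) - ?e i * (?\<zeta> i - 1)" for i
  proof -
    have "?e (Suc i) * exp (- (drift_part u x y (grid T n (Suc i)) \<omega> - drift_part u x y (grid T n i) \<omega>)) = ?e i * ?\<zeta> i"
      using assms unfolding exp_increment_def
      by (subst (1 2) integrand_decomposition)
         (simp_all flip: exp_add, simp add: algebra_simps diff_divide_distrib)
    then show ?thesis by (simp add: algebra_simps)
  qed
  then have "stieltjes_sum u x y T n \<omega> = (\<Sum>i<n. ?e (Suc i) - ?e i) - (\<Sum>i<n. ?e i * (?\<zeta> i - 1))"
    by (simp add: stieltjes_sum_def sum_subtractf)
  also have "(\<Sum>i<n. ?e (Suc i) - ?e i) = integrand Z u x y \<omega> T - integrand Z u x y \<omega> 0"
    using sum_lessThan_telescope[of ?e n] assms by simp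
  finally show ?thesis .
qed

text \<open>The martingale transform has mean zero, so the mean involves only the two end times. The
  point of the last bound is that it does not depend on \<open>n\<close>.\<close>

lemma stieltjes_sum_moments:
  assumes neg: "Re x \<le> 0" "Re y \<le> 0" "Re u \<le> 0" and T: "0 < T" and n: "0 < n"
  shows "integrable M (stieltjes_sum u x y T n)"
    and "expectation (stieltjes_sum u x y T n) =
      expectation (\<lambda>\<omega>. integrand Z u x y \<omega> T) - exp (x * of_real (z0 $ 1) + y * of_real (z0 $ 2))"
    and "integrable M (\<lambda>\<omega>. (norm (stieltjes_sum u x y T n \<omega>))\<^sup>2)"
    and "expectation (\<lambda>\<omega>. (norm (stieltjes_sum u x y T n \<omega>))\<^sup>2)
      \<le> 8 + 2 * (variance_rate x y * T * exp (variance_rate x y * T))"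
proof -
  \<comment> \<open>Chosen so that \<open>1 + c\<close> is the second moment of the martingale ratio
    over one cell.\<close>
  define c where "c = exp (variance_rate x y * (T / n)) - 1"
  define N where "N \<omega> = (\<Sum>i<n. integrand Z u x y \<omega> (grid T n i) *
    (exp_increment x y (grid T n i) (grid T n (Suc i)) \<omega> - 1))" for \<omega>
  have step: "0 \<le> grid T n i" "grid T n i < grid T n (Suc i)" for i
  proof -
    have "0 < T / n" using T n by simp
    then show "grid T n i < grid T n (Suc i)" using grid_step[of T n i] by linarith
  qed (use T in simp)
  have c: "exp (variance_rate x y * (grid T n (Suc i) - grid T n i)) = 1 + c" for i
    by (simp add: c_def grid_step)
  have "integrable M N \<and> expectation N = 0 \<and>
      integrable M (\<lambda>\<omega>. (norm (N \<omega>))\<^sup>2) \<and> expectation (\<lambda>\<omega>. (norm (N \<omega>))\<^sup>2) \<le> n * c"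
    unfolding N_def
    by (intro conjI multiplicative_martingale_transform[where G="\<lambda>i. F (grid T n i)"
          and \<phi>="\<lambda>i \<omega>. integrand Z u x y \<omega> (grid T n i)"
          and \<zeta>="\<lambda>i. exp_increment x y (grid T n i) (grid T n (Suc i))" and c=c]
        subalgebra_F sets_F_mono integrand_measurable exp_increment_measurable exp_increment_indep
        integrable_exp_increment expectation_exp_increment integrable_exp_increment_sq
        norm_integrand_le_one neg eq_refl[OF trans[OF expectation_exp_increment_sq c]])
       (use step less_imp_le in auto)
  then have N: "integrable M N" "expectation N = 0" "integrable M (\<lambda>\<omega>. (norm (N \<omega>))\<^sup>2)"
    "expectation (\<lambda>\<omega>. (norm (N \<omega>))\<^sup>2) \<le> n * c" by auto
  let ?e0 = "exp (x * of_real (z0 $ 1) + y * of_real (z0 $ 2))"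
  let ?D = "\<lambda>\<omega>. integrand Z u x y \<omega> T - ?e0"
  have eq: "stieltjes_sum u x y T n \<omega> = ?D \<omega> - N \<omega>" if "\<omega> \<in> space M" for \<omega>
    using stieltjes_sum_eq[OF that T n, of u x y] initial(3)[OF that]
    by (simp add: N_def integrand_def)
  have [measurable]: "(\<lambda>\<omega>. integrand Z u x y \<omega> T) \<in> borel_measurable M" "N \<in> borel_measurable M"
    using measurable_F[OF integrand_measurable] T N(1) by auto
  have intT: "integrable M (\<lambda>\<omega>. integrand Z u x y \<omega> T)"
    by (rule integrable_const_bound[where B=1]) (use norm_integrand_le_one neg T in auto)
  show S1: "integrable M (stieltjes_sum u x y T n)"
    by (subst Bochner_Integration.integrable_cong[OF refl eq]) (use N(1) intT in auto)
  show "expectation (stieltjes_sum u x y T n) = expectation (\<lambda>\<omega>. integrand Z u x y \<omega> T) - ?e0"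
    by (subst Bochner_Integration.integral_cong[OF refl eq]) (use N(1,2) intT in \<open>auto simp: prob_space\<close>)
  \<comment> \<open>The two end values have norm at most 1, so their difference contributes
    \<open>2 * 2\<^sup>2 = 8\<close>.\<close>
  have le: "(norm (stieltjes_sum u x y T n \<omega>))\<^sup>2 \<le> 8 + 2 * (norm (N \<omega>))\<^sup>2" if \<omega>: "\<omega> \<in> space M" for \<omega>
  proof -
    have "norm ?e0 \<le> 1"
      using norm_integrand_le_one[OF neg \<omega>, of 0] initial(3)[OF \<omega>] by (simp add: integrand_def)
    then have D: "norm (?D \<omega>) \<le> 2"
      using norm_triangle_ineq4[of "integrand Z u x y \<omega> T" ?e0] norm_integrand_le_one[OF neg \<omega> less_imp_le[OF T]] by linarith
    have "(norm (stieltjes_sum u x y T n \<omega>))\<^sup>2 \<le> (norm (?D \<omega>) + norm (N \<omega>))\<^sup>2"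
      unfolding eq[OF \<omega>] by (intro power_mono norm_triangle_ineq4) auto
    also have "\<dots> \<le> 2 * (norm (?D \<omega>))\<^sup>2 + 2 * (norm (N \<omega>))\<^sup>2" by (rule square_add_le)
    also have "(norm (?D \<omega>))\<^sup>2 \<le> 2\<^sup>2" using D by (intro power_mono) auto
    finally show ?thesis by simp
  qed
  show S2: "integrable M (\<lambda>\<omega>. (norm (stieltjes_sum u x y T n \<omega>))\<^sup>2)"
    by (rule Bochner_Integration.integrable_bound[where f="\<lambda>\<omega>. 8 + 2 * (norm (N \<omega>))\<^sup>2"])
       (use N(3) S1 le in \<open>auto intro!: borel_measurable_power borel_measurable_norm\<close>)
  have "expectation (\<lambda>\<omega>. (norm (stieltjes_sum u x y T n \<omega>))\<^sup>2) \<le> expectation (\<lambda>\<omega>. 8 + 2 * (norm (N \<omega>))\<^sup>2)"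
    using S2 N(3) le by (intro integral_mono) auto
  also have "\<dots> = 8 + 2 * expectation (\<lambda>\<omega>. (norm (N \<omega>))\<^sup>2)"
    using N(3) by (simp add: prob_space)
  also have "\<dots> \<le> 8 + 2 * (n * c)" using N(4) by simp
  \<comment> \<open>There are \<open>n\<close> cells, but \<open>c\<close> is of order
    \<open>1 / n\<close>, so the product stays bounded as the mesh shrinks.\<close>
  also have "n * c \<le> variance_rate x y * T * exp (variance_rate x y * T)"
  proof -
    have "n * c \<le> n * (variance_rate x y * (T / n) * exp (variance_rate x y * (T / n)))"
      unfolding c_def by (intro mult_left_mono exp_minus_one_le) simp
    also have "\<dots> = variance_rate x y * T * exp (variance_rate x y * (T / n))"
      using n by simp
    also have "\<dots> \<le> variance_rate x y * T * exp (variance_rate x y * T)"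
    proof -
      have "T / n \<le> T" using n T by (simp add: divide_le_eq)
      then have "variance_rate x y * (T / n) \<le> variance_rate x y * T"
        using variance_rate_nonneg by (intro mult_left_mono)
      then show ?thesis using T variance_rate_nonneg by (intro mult_left_mono) simp_all
    qed
    finally show ?thesis .
  qed
  finally show "expectation (\<lambda>\<omega>. (norm (stieltjes_sum u x y T n \<omega>))\<^sup>2)
      \<le> 8 + 2 * (variance_rate x y * T * exp (variance_rate x y * T))" by simp
qed

text \<open>To first order each factor \<open>1 - exp (- d)\<close> is the increment
  \<open>d\<close> of \<open>drift_part\<close>, which is linear in time and both boundary
  processes. The linearised sum is thus a combination of three Riemann sums.\<close>

lemma stieltjes_sum_tendsto:
  assumes neg: "Re x \<le> 0" "Re y \<le> 0" "Re u \<le> 0" and T: "0 < T" and \<omega>: "\<omega> \<in> space M"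
  shows "(\<lambda>n. stieltjes_sum u x y T n \<omega>) \<longlonglongrightarrow>
      (kernel_K \<rho> \<mu> x y + u) * (LINT t:{0<..T}|lborel. integrand Z u x y \<omega> t)
    + kernel_k1 r1 x y * (LINT t:{0<..T}|stieltjes (\<lambda>s. L s \<omega> $ 1). integrand Z u x y \<omega> t)
    + kernel_k2 r2 x y * (LINT t:{0<..T}|stieltjes (\<lambda>s. L s \<omega> $ 2). integrand Z u x y \<omega> t)"
    (is "_ \<longlonglongrightarrow> ?I")
proof -
  let ?e = "integrand Z u x y \<omega>" and ?f = "\<lambda>t. drift_part u x y t \<omega>"
  let ?\<kappa> = "kernel_K \<rho> \<mu> x y + u" and ?k1 = "kernel_k1 r1 x y" and ?k2 = "kernel_k2 r2 x y"
  note ci = continuous_integrand_integrand[of u x y]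
  have "(\<lambda>n. ?\<kappa> * riemann_sum (\<lambda>t. t) ?e T n + ?k1 * riemann_sum (\<lambda>t. L t \<omega> $ 1) ?e T n
      + ?k2 * riemann_sum (\<lambda>t. L t \<omega> $ 2) ?e T n) \<longlonglongrightarrow> ?I"
    by (intro tendsto_add tendsto_mult tendsto_const clock.riemann_sum_tendsto_path[OF ci T \<omega>]
        L1.riemann_sum_tendsto_path[OF ci T \<omega>] L2.riemann_sum_tendsto_path[OF ci T \<omega>])
  moreover have "?\<kappa> * riemann_sum (\<lambda>t. t) ?e T n + ?k1 * riemann_sum (\<lambda>t. L t \<omega> $ 1) ?e T n
      + ?k2 * riemann_sum (\<lambda>t. L t \<omega> $ 2) ?e T n
      = (\<Sum>i<n. ?e (grid T n (Suc i)) * (?f (grid T n (Suc i)) - ?f (grid T n i)))" for n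
    unfolding riemann_sum_def sum_distrib_left sum.distrib[symmetric] drift_part_def
    by (intro sum.cong refl) (simp add: scaleR_conv_of_real algebra_simps)
  ultimately have lim: "(\<lambda>n. \<Sum>i<n. ?e (grid T n (Suc i)) * (?f (grid T n (Suc i)) - ?f (grid T n i))) \<longlonglongrightarrow> ?I"
    by simp
  \<comment> \<open>A majorant of the variation of \<open>drift_part\<close>; it uses that the
    components of \<open>L\<close> are nondecreasing.\<close>
  define m where "m t = norm ?\<kappa> * t + norm ?k1 * L t \<omega> $ 1 + norm ?k2 * L t \<omega> $ 2" for t
  have "(\<lambda>n. stieltjes_sum u x y T n \<omega>
      - (\<Sum>i<n. ?e (grid T n (Suc i)) * (?f (grid T n (Suc i)) - ?f (grid T n i)))) \<longlonglongrightarrow> 0"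
    unfolding stieltjes_sum_def
  proof (rule exp_increment_sum_tendsto[OF T, where m=m])
    show "continuous_on {0..T} ?f"
      unfolding drift_part_def
      by (intro continuous_on_add continuous_on_mult continuous_on_of_real continuous_on_const continuous_on_id
          continuous_on_subset[OF continuous_path(2)[OF \<omega>]]) auto
    show "norm (?e (grid T n (Suc i))) \<le> 1" for n i
      using T by (intro norm_integrand_le_one neg \<omega>) simp
    show "norm (?f t - ?f s) \<le> m t - m s" if st: "0 \<le> s" "s \<le> t" for s t
    proof -
      have "?f t - ?f s = ?\<kappa> * of_real (t - s) + ?k1 * of_real (L t \<omega> $ 1 - L s \<omega> $ 1)
          + ?k2 * of_real (L t \<omega> $ 2 - L s \<omega> $ 2)"
        by (simp add: drift_part_def algebra_simps)
      also have "norm \<dots> \<le> norm (?\<kappa> * of_real (t - s)) + norm (?k1 * of_real (L t \<omega> $ 1 - L s \<omega> $ 1))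
          + norm (?k2 * of_real (L t \<omega> $ 2 - L s \<omega> $ 2))"
        by (intro norm_triangle_le add_mono norm_triangle_ineq) simp
      also have "\<dots> = m t - m s"
        unfolding norm_mult norm_of_real m_def
        using st L_mono[OF \<omega> st, of 1] L_mono[OF \<omega> st, of 2] by (simp add: algebra_simps)
      finally show ?thesis .
    qed
  qed
  from tendsto_add[OF this lim] show ?thesis by simp
qed

text \<open>The three integrals stand under one expectation, since the second moment bound controls
  only their combination. They are separated once each is known to be integrable.\<close>

lemma expectation_identity:
  assumes neg: "Re x \<le> 0" "Re y \<le> 0" "Re u \<le> 0" and T: "0 < T"
  shows "expectation (\<lambda>\<omega>. (kernel_K \<rho> \<mu> x y + u) * (LINT t:{0<..T}|lborel. integrand Z u x y \<omega> t)
    + kernel_k1 r1 x y * (LINT t:{0<..T}|stieltjes (\<lambda>s. L s \<omega> $ 1). integrand Z u x y \<omega> t)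
    + kernel_k2 r2 x y * (LINT t:{0<..T}|stieltjes (\<lambda>s. L s \<omega> $ 2). integrand Z u x y \<omega> t))
    = expectation (\<lambda>\<omega>. integrand Z u x y \<omega> T) - exp (x * of_real (z0 $ 1) + y * of_real (z0 $ 2))"
    (is "expectation ?I = ?E")
proof -
  note ci = continuous_integrand_integrand[of u x y]
  note S = stieltjes_sum_moments[OF neg T zero_less_Suc]
  \<comment> \<open>The shift to \<open>Suc n\<close> avoids the empty partition. By the moment
    formula this sequence of means is in fact constant.\<close>
  have "(\<lambda>n. expectation (stieltjes_sum u x y T (Suc n))) \<longlonglongrightarrow> expectation ?I"
  proof (rule expectation_tendsto_L2_bounded(2)[OF _ _ _ S(3,4)])
    show "random_variable borel (stieltjes_sum u x y T (Suc n))" for n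
      using S(1) by (rule borel_measurable_integrable)
    show "random_variable borel ?I"
      by (intro borel_measurable_add borel_measurable_times borel_measurable_const
          clock.measurable_integral_Ioc[OF ci T] L1.measurable_integral_Ioc[OF ci T] L2.measurable_integral_Ioc[OF ci T])
    show "AE \<omega> in M. (\<lambda>n. stieltjes_sum u x y T (Suc n) \<omega>) \<longlonglongrightarrow> ?I \<omega>"
      by (intro AE_I2 LIMSEQ_Suc stieltjes_sum_tendsto[OF neg T])
  qed
  then have "(\<lambda>n. ?E) \<longlonglongrightarrow> expectation ?I" by (simp only: S(2))
  then show ?thesis by (simp add: LIMSEQ_const_iff)
qed

section \<open>Integrability along the boundary\<close>

text \<open>Along a direction \<open>w\<close> pushed inwards by both reflections, \<open>V\<close> is nonincreasing, so all
  summands of the Stieltjes sum have the same sign and its expectation controls the boundary processes.\<close>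

lemma riemann_sum_boundary_le:
  fixes w1 w2 v :: real
  assumes w: "0 \<le> w1" "0 \<le> w2" and v: "v \<le> 0"
    and inward: "0 < w1 + r1 * w2" "0 < r2 * w1 + w2"
    and K: "(w1\<^sup>2 + w2\<^sup>2 + 2 * \<rho> * w1 * w2) / 2 - \<mu> $ 1 * w1 - \<mu> $ 2 * w2 + v \<le> 0"
    and \<alpha>: "\<alpha> = (if i = 1 then w1 + r1 * w2 else r2 * w1 + w2)" and T: "0 < T"
  shows "(\<integral>\<^sup>+\<omega>. ennreal (riemann_sum (\<lambda>t. L t \<omega> $ i)
      (\<lambda>t. exp (- w1 * Z t \<omega> $ 1 - w2 * Z t \<omega> $ 2 + v * t)) T n) \<partial>M) \<le> ennreal (1 / \<alpha>)"
proof (cases "n = 0")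
  case False
  then have n: "0 < n" by simp
  \<comment> \<open>This is \<open>kernel_K + u\<close> at \<open>x = - w1\<close>,
    \<open>y = - w2\<close>, \<open>u = v\<close>; it is nonpositive by assumption.\<close>
  define \<kappa> where "\<kappa> = (w1\<^sup>2 + w2\<^sup>2 + 2 * \<rho> * w1 * w2) / 2 - \<mu> $ 1 * w1 - \<mu> $ 2 * w2 + v"
  let ?x = "- complex_of_real w1" and ?y = "- complex_of_real w2" and ?u = "complex_of_real v"
  define h where "h \<omega> t = exp (- w1 * Z t \<omega> $ 1 - w2 * Z t \<omega> $ 2 + v * t)" for \<omega> t
  define S where "S = stieltjes_sum ?u ?x ?y T n"
  have \<alpha>0: "0 < \<alpha>" using inward by (simp add: \<alpha>)
  have e: "integrand Z ?u ?x ?y \<omega> t = of_real (h \<omega> t)" for \<omega> t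
    by (simp add: integrand_def h_def exp_of_real[symmetric])
  have d: "drift_part ?u ?x ?y t \<omega> = of_real (\<kappa> * t - (w1 + r1 * w2) * L t \<omega> $ 1 - (r2 * w1 + w2) * L t \<omega> $ 2)" for \<omega> t
    by (simp add: drift_part_def kernel_K_def kernel_k1_def kernel_k2_def \<kappa>_def algebra_simps)
  have neg: "Re ?x \<le> 0" "Re ?y \<le> 0" "Re ?u \<le> 0" using w v by auto
  note moments = stieltjes_sum_moments[OF neg T n, folded S_def]
  have S_le: "\<alpha> * riemann_sum (\<lambda>t. L t \<omega> $ i) (h \<omega>) T n \<le> - Re (S \<omega>)" if \<omega>: "\<omega> \<in> space M" for \<omega>
  proof -
    have term_le: "\<alpha> * ((L t \<omega> $ i - L s \<omega> $ i) * h \<omega> t) \<le>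
        - Re (integrand Z ?u ?x ?y \<omega> t * (1 - exp (- (drift_part ?u ?x ?y t \<omega> - drift_part ?u ?x ?y s \<omega>))))"
      if st: "0 \<le> s" "s \<le> t" for s t
    proof -
      \<comment> \<open>Minus the increment of \<open>drift_part\<close>: a sum of three nonnegative
        terms, one of which is \<open>\<alpha>\<close> times the increment of the chosen boundary
        process. The other two are discarded, and \<open>\<delta> \<le> exp \<delta> - 1\<close>
        links it to the Stieltjes sum.\<close>
      define \<delta> where "\<delta> = - \<kappa> * (t - s) + (w1 + r1 * w2) * (L t \<omega> $ 1 - L s \<omega> $ 1)
        + (r2 * w1 + w2) * (L t \<omega> $ 2 - L s \<omega> $ 2)"
      have "- (drift_part ?u ?x ?y t \<omega> - drift_part ?u ?x ?y s \<omega>) = of_real \<delta>"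
        unfolding d \<delta>_def by (simp add: algebra_simps)
      then have rhs: "- Re (integrand Z ?u ?x ?y \<omega> t * (1 - exp (- (drift_part ?u ?x ?y t \<omega> - drift_part ?u ?x ?y s \<omega>))))
          = (exp \<delta> - 1) * h \<omega> t"
        by (simp only: e exp_of_real) (simp add: algebra_simps)
      have "0 \<le> - \<kappa> * (t - s)" using K st by (intro mult_nonneg_nonneg) (auto simp: \<kappa>_def)
      moreover have "0 \<le> (w1 + r1 * w2) * (L t \<omega> $ 1 - L s \<omega> $ 1)" "0 \<le> (r2 * w1 + w2) * (L t \<omega> $ 2 - L s \<omega> $ 2)"
        using inward L_mono[OF \<omega> st] by (auto intro!: mult_nonneg_nonneg)
      ultimately have "\<alpha> * (L t \<omega> $ i - L s \<omega> $ i) \<le> \<delta>"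
        using exhaust_2[of i] by (auto simp: \<alpha> \<delta>_def)
      also have "\<delta> \<le> exp \<delta> - 1" using exp_ge_add_one_self[of \<delta>] by linarith
      finally have "\<alpha> * (L t \<omega> $ i - L s \<omega> $ i) * h \<omega> t \<le> (exp \<delta> - 1) * h \<omega> t"
        by (intro mult_right_mono) (auto simp: h_def)
      then show ?thesis unfolding rhs by (simp only: mult.assoc)
    qed
    show ?thesis
      unfolding S_def stieltjes_sum_def riemann_sum_def Re_sum sum_distrib_left sum_negf[symmetric] real_scaleR_def
      using T by (intro sum_mono term_le grid_mono) simp_all
  qed
  have "(\<integral>\<^sup>+\<omega>. ennreal (riemann_sum (\<lambda>t. L t \<omega> $ i) (h \<omega>) T n) \<partial>M) \<le> (\<integral>\<^sup>+\<omega>. ennreal (- Re (S \<omega>) / \<alpha>) \<partial>M)"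
    using \<alpha>0 S_le by (intro nn_integral_mono ennreal_leI) (simp add: field_simps)
  also have "\<dots> = ennreal (expectation (\<lambda>\<omega>. - Re (S \<omega>) / \<alpha>))"
  proof (rule nn_integral_eq_integral)
    show "integrable M (\<lambda>\<omega>. - Re (S \<omega>) / \<alpha>)" using moments(1) by simp
    show "AE \<omega> in M. 0 \<le> - Re (S \<omega>) / \<alpha>"
    proof (rule AE_I2)
      fix \<omega> assume \<omega>: "\<omega> \<in> space M"
      have "0 \<le> riemann_sum (\<lambda>t. L t \<omega> $ i) (h \<omega>) T n"
        unfolding riemann_sum_def using T
        by (intro sum_nonneg) (auto simp: h_def intro!: mult_nonneg_nonneg L_mono[OF \<omega>] grid_mono)
      then have "0 \<le> \<alpha> * riemann_sum (\<lambda>t. L t \<omega> $ i) (h \<omega>) T n" using \<alpha>0 by simp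
      also have "\<dots> \<le> - Re (S \<omega>)" by (rule S_le[OF \<omega>])
      finally show "0 \<le> - Re (S \<omega>) / \<alpha>" using \<alpha>0 by (intro divide_nonneg_pos)
    qed
  qed
  also have "expectation (\<lambda>\<omega>. - Re (S \<omega>) / \<alpha>) \<le> 1 / \<alpha>"
  proof -
    have "expectation (\<lambda>\<omega>. - Re (S \<omega>) / \<alpha>) = - Re (expectation S) / \<alpha>"
      using moments(1) by simp
    also have "Re (expectation S) = expectation (\<lambda>\<omega>. h \<omega> T) - exp (- w1 * z0 $ 1 - w2 * z0 $ 2)"
    proof -
      have "exp (?x * of_real (z0 $ 1) + ?y * of_real (z0 $ 2)) = of_real (exp (- w1 * z0 $ 1 - w2 * z0 $ 2))"
        by (simp add: exp_of_real[symmetric])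
      then show ?thesis unfolding moments(2) e integral_complex_of_real by simp
    qed
    \<comment> \<open>The initial value is at most 1 and the terminal mean is nonnegative. That
      \<open>z0\<close> lies in the quadrant is read off from the path at time 0 for any sample
      point.\<close>
    also have "- (expectation (\<lambda>\<omega>. h \<omega> T) - exp (- w1 * z0 $ 1 - w2 * z0 $ 2)) / \<alpha> \<le> 1 / \<alpha>"
    proof (rule divide_right_mono)
      obtain \<omega> where \<omega>: "\<omega> \<in> space M" using not_empty by blast
      have "0 \<le> z0 $ 1" "0 \<le> z0 $ 2"
        using Z_nonneg[OF \<omega>, of 0] initial(3)[OF \<omega>] by (metis order_refl)+
      then have "0 \<le> w1 * z0 $ 1" "0 \<le> w2 * z0 $ 2" using w by simp_all
      then have "exp (- w1 * z0 $ 1 - w2 * z0 $ 2) \<le> 1" by simp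
      moreover have "0 \<le> expectation (\<lambda>\<omega>. h \<omega> T)" by (simp add: h_def)
      ultimately show "- (expectation (\<lambda>\<omega>. h \<omega> T) - exp (- w1 * z0 $ 1 - w2 * z0 $ 2)) \<le> 1" by linarith
    qed (use \<alpha>0 in simp)
    finally show ?thesis .
  qed
  finally show ?thesis by (simp only: h_def[abs_def] ennreal_leI)
qed (simp add: riemann_sum_def)

lemma nn_integral_boundary_finite:
  fixes w1 w2 v :: real
  assumes w: "0 \<le> w1" "0 \<le> w2" and v: "v \<le> 0"
    and inward: "0 < w1 + r1 * w2" "0 < r2 * w1 + w2"
    and K: "(w1\<^sup>2 + w2\<^sup>2 + 2 * \<rho> * w1 * w2) / 2 - \<mu> $ 1 * w1 - \<mu> $ 2 * w2 + v \<le> 0"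
  shows "(\<integral>\<^sup>+\<omega>. (\<integral>\<^sup>+t\<in>{0..}. ennreal (exp (- w1 * Z t \<omega> $ 1 - w2 * Z t \<omega> $ 2 + v * t))
    \<partial>stieltjes (\<lambda>s. L s \<omega> $ i)) \<partial>M) < \<infinity>"
proof -
  interpret Li: random_distribution M "\<lambda>\<omega>. stieltjes (\<lambda>s. L s \<omega> $ i)" "\<lambda>\<omega> t. L t \<omega> $ i"
    by (rule random_distribution_L)
  have ci: "Li.continuous_integrand (\<lambda>\<omega> t. exp (- w1 * Z t \<omega> $ 1 - w2 * Z t \<omega> $ 2 + v * t))"
    using clock.continuous_integrand_norm[OF continuous_integrand_integrand[of "of_real v" "of_real (- w1)" "of_real (- w2)"]]
    unfolding norm_integrand by simp
  have "(\<integral>\<^sup>+\<omega>. (\<integral>\<^sup>+t\<in>{0..}. ennreal (exp (- w1 * Z t \<omega> $ 1 - w2 * Z t \<omega> $ 2 + v * t))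
    \<partial>stieltjes (\<lambda>s. L s \<omega> $ i)) \<partial>M) \<le> ennreal (1 / (if i = 1 then w1 + r1 * w2 else r2 * w1 + w2))"
    by (rule Li.nn_integral_path_le[OF ci _ riemann_sum_boundary_le[OF w v inward K refl]]) auto
  also have "\<dots> < \<infinity>" by simp
  finally show ?thesis .
qed

text \<open>A small multiple of an inward direction works, since the kernel at
  \<open>(- w1, - w2)\<close> tends to 0 with the multiple. With \<open>a = - Re x\<close>,
  \<open>b = - Re y\<close>, \<open>c = - Re u\<close>, the resulting real exponential dominates the
  complex integrand and meets the sign condition for the boundary estimate.\<close>

lemma exists_dominating_direction:
  assumes R: "1 - r1 * r2 > 0 \<or> (r1 > 0 \<and> r2 > 0)" and pos: "0 < a" "0 < b" "0 < c"
  obtains w1 w2 where "0 \<le> w1" "w1 \<le> a" "0 \<le> w2" "w2 \<le> b" "0 < w1 + r1 * w2" "0 < r2 * w1 + w2"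
    "(w1\<^sup>2 + w2\<^sup>2 + 2 * \<rho> * w1 * w2) / 2 - \<mu> $ 1 * w1 - \<mu> $ 2 * w2 \<le> c"
proof -
  obtain v1 v2 where v: "0 < v1" "0 < v2" "0 < v1 + r1 * v2" "0 < r2 * v1 + v2"
    using exists_inward_direction[OF R] .
  define q where "q \<epsilon> = ((\<epsilon> * v1)\<^sup>2 + (\<epsilon> * v2)\<^sup>2 + 2 * \<rho> * (\<epsilon> * v1) * (\<epsilon> * v2)) / 2
    - \<mu> $ 1 * (\<epsilon> * v1) - \<mu> $ 2 * (\<epsilon> * v2)" for \<epsilon>
  have "(q \<longlongrightarrow> q 0) (at_right 0)"
    unfolding q_def by (intro tendsto_intros) auto
  then have lim: "(q \<longlongrightarrow> 0) (at_right 0)" by (simp add: q_def)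
  have "((\<lambda>\<epsilon>. \<epsilon> * v) \<longlongrightarrow> 0) (at_right 0)" for v :: real
    by (auto intro!: tendsto_eq_intros)
  with lim have "\<forall>\<^sub>F \<epsilon> in at_right 0. q \<epsilon> < c \<and> \<epsilon> * v1 < a \<and> \<epsilon> * v2 < b"
    using pos by (auto intro!: eventually_conj order_tendstoD(2))
  then have "\<forall>\<^sub>F \<epsilon> in at_right 0. q \<epsilon> < c \<and> \<epsilon> * v1 < a \<and> \<epsilon> * v2 < b \<and> 0 < (\<epsilon>::real)"
    using eventually_at_right_less by eventually_elim simp
  then obtain \<epsilon> where \<epsilon>: "q \<epsilon> < c" "\<epsilon> * v1 < a" "\<epsilon> * v2 < b" "0 < \<epsilon>"
    by (auto dest: eventually_happens)
  have "0 < \<epsilon> * (v1 + r1 * v2)" "0 < \<epsilon> * (r2 * v1 + v2)" using v \<epsilon> by simp_all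
  then show thesis
    using that[of "\<epsilon> * v1" "\<epsilon> * v2"] v \<epsilon> by (simp add: q_def algebra_simps)
qed

text \<open>Separate integrability splits the finite time identity into three expectations.
  Dominated convergence then passes each to the infinite horizon.\<close>

lemma functional_equation:
  assumes R: "1 - r1 * r2 > 0 \<or> (r1 > 0 \<and> r2 > 0)"
    and neg: "Re x < 0" "Re y < 0" "Re u < 0"
  shows "path_expectation_exists M (\<lambda>_. lborel) (integrand Z u x y)"
    and "path_expectation_exists M (\<lambda>\<omega>. stieltjes (\<lambda>s. L s \<omega> $ 1)) (integrand Z u 0 y)"
    and "path_expectation_exists M (\<lambda>\<omega>. stieltjes (\<lambda>s. L s \<omega> $ 2)) (integrand Z u x 0)"
    and "- (kernel_K \<rho> \<mu> x y + u) * p_hat M Z u x y =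
      kernel_k1 r1 x y * p1_hat M Z L u y + kernel_k2 r2 x y * p2_hat M Z L u x
      + exp (x * of_real (z0 $ 1) + y * of_real (z0 $ 2))"
proof -
  have neg': "Re x \<le> 0" "Re y \<le> 0" "Re u \<le> 0" using neg by auto
  obtain w1 w2 where w: "0 \<le> w1" "w1 \<le> - Re x" "0 \<le> w2" "w2 \<le> - Re y"
    and inward: "0 < w1 + r1 * w2" "0 < r2 * w1 + w2"
    and "(w1\<^sup>2 + w2\<^sup>2 + 2 * \<rho> * w1 * w2) / 2 - \<mu> $ 1 * w1 - \<mu> $ 2 * w2 \<le> - Re u"
    using exists_dominating_direction[OF R, of "- Re x" "- Re y" "- Re u"] neg by auto
  then have K: "(w1\<^sup>2 + w2\<^sup>2 + 2 * \<rho> * w1 * w2) / 2 - \<mu> $ 1 * w1 - \<mu> $ 2 * w2 + Re u \<le> 0" by simp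
  define h where "h \<omega> t = exp (- w1 * Z t \<omega> $ 1 - w2 * Z t \<omega> $ 2 + Re u * t)" for \<omega> t
  have fin: "(\<integral>\<^sup>+\<omega>. (\<integral>\<^sup>+t\<in>{0..}. ennreal (h \<omega> t) \<partial>stieltjes (\<lambda>s. L s \<omega> $ i)) \<partial>M) < \<infinity>" for i
    unfolding h_def by (rule nn_integral_boundary_finite[OF w(1,3) neg'(3) inward K])
  have dom: "w1 * Z t \<omega> $ 1 \<le> - Re x * Z t \<omega> $ 1" "w2 * Z t \<omega> $ 2 \<le> - Re y * Z t \<omega> $ 2"
    if "\<omega> \<in> space M" "0 \<le> t" for \<omega> t
    by (rule mult_right_mono[OF w(2) Z_nonneg[OF that]], rule mult_right_mono[OF w(4) Z_nonneg[OF that]])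
  have le: "norm (integrand Z u x y \<omega> t) \<le> h \<omega> t" if "\<omega> \<in> space M" "0 \<le> t" for \<omega> t
    using dom[OF that] by (simp add: norm_integrand h_def)
  \<comment> \<open>Where the first coordinate vanishes, \<open>w1\<close> and \<open>x\<close> do
    not affect the exponentials, so the same majorant also covers the integrand with
    \<open>x\<close> replaced by 0.\<close>
  have le1: "norm (integrand Z u 0 y \<omega> t) \<le> h \<omega> t" if "\<omega> \<in> space M" "0 \<le> t" "Z t \<omega> $ 1 = 0" for \<omega> t
    using dom[OF that(1,2)] that(3) by (simp add: norm_integrand h_def)
  have le2: "norm (integrand Z u x 0 \<omega> t) \<le> h \<omega> t" if "\<omega> \<in> space M" "0 \<le> t" "Z t \<omega> $ 2 = 0" for \<omega> t
    using dom[OF that(1,2)] that(3) by (simp add: norm_integrand h_def)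
  note ci = continuous_integrand_integrand

  \<comment> \<open>In the interior the discount factor alone is integrable in time.\<close>
  have clock_le: "AE t in lborel. 0 \<le> t \<longrightarrow> norm (integrand Z u x y \<omega> t) \<le> exp (Re u * t)" if "\<omega> \<in> space M" for \<omega>
  proof (intro AE_I2 impI)
    fix t :: real assume "0 \<le> t"
    then show "norm (integrand Z u x y \<omega> t) \<le> exp (Re u * t)"
      using Z_nonneg[OF that, of t] neg'
      by (auto simp: norm_integrand intro!: add_nonpos_nonpos mult_nonpos_nonneg)
  qed
  have "(\<integral>\<^sup>+t\<in>{0..}. ennreal (exp (Re u * t)) \<partial>lborel) = ennreal (0 - exp (Re u * 0) / Re u)"
  proof (rule nn_integral_FTC_atLeast)
    show "((\<lambda>t. exp (Re u * t) / Re u) has_real_derivative exp (Re u * t)) (at t)" for t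
      using neg by (auto intro!: derivative_eq_intros)
    have "filterlim (\<lambda>t. Re u * t) at_bot at_top"
      using neg by (intro filterlim_tendsto_neg_mult_at_bot[OF tendsto_const _ filterlim_ident])
    then have "((\<lambda>t. exp (Re u * t)) \<longlongrightarrow> 0) at_top" by (rule filterlim_compose[OF exp_at_bot])
    then show "((\<lambda>t. exp (Re u * t) / Re u) \<longlongrightarrow> 0) at_top"
      by (rule tendsto_divide_zero)
  qed auto
  then have clock_fin: "(\<integral>\<^sup>+\<omega>. (\<integral>\<^sup>+t\<in>{0..}. ennreal (exp (Re u * t)) \<partial>lborel) \<partial>M) < \<infinity>"
    by (simp add: emeasure_space_1)
  note p0 = clock.path_expectation_dominated[OF ci clock_le clock_fin]
  have le1': "AE t in stieltjes (\<lambda>s. L s \<omega> $ i). 0 \<le> t \<longrightarrow> norm (integrand Z u x y \<omega> t) \<le> h \<omega> t"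
    if "\<omega> \<in> space M" for \<omega> i using le[OF that] by simp
  note p1 = L1.path_expectation_dominated[OF ci le1' fin]
  note p2 = L2.path_expectation_dominated[OF ci le1' fin]

  show "path_expectation_exists M (\<lambda>_. lborel) (integrand Z u x y)" by (rule p0(1))
  show "path_expectation_exists M (\<lambda>\<omega>. stieltjes (\<lambda>s. L s \<omega> $ 1)) (integrand Z u 0 y)"
  proof (rule L1.path_expectation_dominated(1)[OF ci _ fin])
    fix \<omega> assume "\<omega> \<in> space M"
    from AE_boundary[OF this, of 1] le1[OF this]
    show "AE t in stieltjes (\<lambda>s. L s \<omega> $ 1). 0 \<le> t \<longrightarrow> norm (integrand Z u 0 y \<omega> t) \<le> h \<omega> t" by auto
  qed
  show "path_expectation_exists M (\<lambda>\<omega>. stieltjes (\<lambda>s. L s \<omega> $ 2)) (integrand Z u x 0)"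
  proof (rule L2.path_expectation_dominated(1)[OF ci _ fin])
    fix \<omega> assume "\<omega> \<in> space M"
    from AE_boundary[OF this, of 2] le2[OF this]
    show "AE t in stieltjes (\<lambda>s. L s \<omega> $ 2). 0 \<le> t \<longrightarrow> norm (integrand Z u x 0 \<omega> t) \<le> h \<omega> t" by auto
  qed

  have meas: "set_borel_measurable (stieltjes l) {0..} (integrand Z u' x' y' \<omega>)" if "\<omega> \<in> space M" for l u' x' y' \<omega>
    using set_measurable_continuous_on[of "{0..}" "integrand Z u' x' y' \<omega>"] ci[of u' x' y'] that
    by (auto simp: clock.continuous_integrand_def set_borel_measurable_def stieltjes_def cong: measurable_cong_sets)
  \<comment> \<open>The first boundary measure lives where the first coordinate is 0, so
    \<open>x\<close> may be replaced by 0 inside its integral.\<close>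
  have p1_eq: "path_expectation M (\<lambda>\<omega>. stieltjes (\<lambda>s. L s \<omega> $ 1)) (integrand Z u x y) = p1_hat M Z L u y"
    unfolding p1_hat_def path_expectation_def
  proof (rule Bochner_Integration.integral_cong[OF refl])
    fix \<omega> assume \<omega>: "\<omega> \<in> space M"
    have "AE t in stieltjes (\<lambda>s. L s \<omega> $ 1).
        indicator {0..} t *\<^sub>R integrand Z u x y \<omega> t = indicator {0..} t *\<^sub>R integrand Z u 0 y \<omega> t"
      using AE_boundary[OF \<omega>, of 1] by eventually_elim (auto simp: integrand_def indicator_def)
    then show "(LINT t:{0..}|stieltjes (\<lambda>s. L s \<omega> $ 1). integrand Z u x y \<omega> t)
        = (LINT t:{0..}|stieltjes (\<lambda>s. L s \<omega> $ 1). integrand Z u 0 y \<omega> t)"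
      unfolding set_lebesgue_integral_def
      by (rule integral_cong_AE[OF meas[unfolded set_borel_measurable_def, OF \<omega>] meas[unfolded set_borel_measurable_def, OF \<omega>]])
  qed
  have p2_eq: "path_expectation M (\<lambda>\<omega>. stieltjes (\<lambda>s. L s \<omega> $ 2)) (integrand Z u x y) = p2_hat M Z L u x"
    unfolding p2_hat_def path_expectation_def
  proof (rule Bochner_Integration.integral_cong[OF refl])
    fix \<omega> assume \<omega>: "\<omega> \<in> space M"
    have "AE t in stieltjes (\<lambda>s. L s \<omega> $ 2).
        indicator {0..} t *\<^sub>R integrand Z u x y \<omega> t = indicator {0..} t *\<^sub>R integrand Z u x 0 \<omega> t"
      using AE_boundary[OF \<omega>, of 2] by eventually_elim (auto simp: integrand_def indicator_def)
    then show "(LINT t:{0..}|stieltjes (\<lambda>s. L s \<omega> $ 2). integrand Z u x y \<omega> t)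
        = (LINT t:{0..}|stieltjes (\<lambda>s. L s \<omega> $ 2). integrand Z u x 0 \<omega> t)"
      unfolding set_lebesgue_integral_def
      by (rule integral_cong_AE[OF meas[unfolded set_borel_measurable_def, OF \<omega>] meas[unfolded set_borel_measurable_def, OF \<omega>]])
  qed

  let ?\<kappa> = "kernel_K \<rho> \<mu> x y + u" and ?k1 = "kernel_k1 r1 x y" and ?k2 = "kernel_k2 r2 x y"
  let ?e0 = "exp (x * of_real (z0 $ 1) + y * of_real (z0 $ 2))"
  define I0 where "I0 k = (LINT \<omega>|M. (LINT t:{0<..real (Suc k)}|lborel. integrand Z u x y \<omega> t))" for k
  define I1 where "I1 k = (LINT \<omega>|M. (LINT t:{0<..real (Suc k)}|stieltjes (\<lambda>s. L s \<omega> $ 1). integrand Z u x y \<omega> t))" for k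
  define I2 where "I2 k = (LINT \<omega>|M. (LINT t:{0<..real (Suc k)}|stieltjes (\<lambda>s. L s \<omega> $ 2). integrand Z u x y \<omega> t))" for k
  have finite_time: "?\<kappa> * I0 k + ?k1 * I1 k + ?k2 * I2 k = expectation (\<lambda>\<omega>. integrand Z u x y \<omega> (real (Suc k))) - ?e0" for k
    using expectation_identity[OF neg', of "real (Suc k)"] p0(2)[of k] p1(2)[of k] p2(2)[of k]
    by (simp add: I0_def I1_def I2_def)
  have "(\<lambda>k. ?\<kappa> * I0 k + ?k1 * I1 k + ?k2 * I2 k) \<longlonglongrightarrow>
      ?\<kappa> * p_hat M Z u x y + ?k1 * p1_hat M Z L u y + ?k2 * p2_hat M Z L u x"
    unfolding I0_def I1_def I2_def p_hat_def p1_eq[symmetric] p2_eq[symmetric]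
    by (intro tendsto_intros p0(3) p1(3) p2(3))
  \<comment> \<open>The terminal term dies out because the integrand at time \<open>Suc k\<close>
    has norm at most \<open>exp (Re u) ^ Suc k\<close> with \<open>Re u < 0\<close>.\<close>
  moreover have "(\<lambda>k. expectation (\<lambda>\<omega>. integrand Z u x y \<omega> (real (Suc k))) - ?e0) \<longlonglongrightarrow> 0 - ?e0"
  proof (intro tendsto_diff tendsto_const)
    show "(\<lambda>k. expectation (\<lambda>\<omega>. integrand Z u x y \<omega> (real (Suc k)))) \<longlonglongrightarrow> 0"
    proof (rule Lim_null_comparison)
      show "\<forall>\<^sub>F k in sequentially. norm (expectation (\<lambda>\<omega>. integrand Z u x y \<omega> (real (Suc k)))) \<le> exp (Re u) ^ Suc k"
      proof (intro always_eventually allI)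
        fix k
        let ?T = "real (Suc k)"
        have le: "norm (integrand Z u x y \<omega> ?T) \<le> exp (Re u) ^ Suc k" if "\<omega> \<in> space M" for \<omega>
          unfolding norm_integrand exp_of_nat_mult[symmetric]
          using Z_nonneg[OF that, of ?T] neg'
          by (auto simp: mult.commute[of "Re u"] intro!: add_nonpos_nonpos mult_nonpos_nonneg)
        have "norm (expectation (\<lambda>\<omega>. integrand Z u x y \<omega> ?T)) \<le> expectation (\<lambda>\<omega>. norm (integrand Z u x y \<omega> ?T))"
          by (rule integral_norm_bound)
        also have "\<dots> \<le> expectation (\<lambda>_. exp (Re u) ^ Suc k)"
        proof (rule integral_mono)
          show "integrable M (\<lambda>\<omega>. norm (integrand Z u x y \<omega> ?T))"
            by (rule integrable_const_bound[where B="exp (Re u) ^ Suc k"])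
               (use le measurable_F[OF integrand_measurable[of ?T]] in auto)
        qed (use le in auto)
        finally show "norm (expectation (\<lambda>\<omega>. integrand Z u x y \<omega> ?T)) \<le> exp (Re u) ^ Suc k"
          by (simp add: prob_space)
      qed
      show "(\<lambda>k. exp (Re u) ^ Suc k) \<longlonglongrightarrow> 0"
        using neg by (intro LIMSEQ_Suc LIMSEQ_power_zero) simp
    qed
  qed
  ultimately have "?\<kappa> * p_hat M Z u x y + ?k1 * p1_hat M Z L u y + ?k2 * p2_hat M Z L u x = 0 - ?e0"
    unfolding finite_time by (rule LIMSEQ_unique)
  then show "- (?\<kappa>) * p_hat M Z u x y = ?k1 * p1_hat M Z L u y + ?k2 * p2_hat M Z L u x + ?e0"
    by algebra
qed

end

theorem proposition6p1:
  fixes M :: "'a measure" and F :: "real \<Rightarrow> 'a measure"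
    and Z B L :: "real \<Rightarrow> 'a \<Rightarrow> real^2"
    and z0 \<mu> :: "real^2" and \<rho> r1 r2 :: real
    and x y u :: complex
  assumes "-1 < \<rho>" and "\<rho> < 1"
    and "(\<mu> $ 1)\<^sup>2 + (\<mu> $ 2)\<^sup>2 = 1"
    and "1 - r1 * r2 > 0 \<or> (r1 > 0 \<and> r2 > 0)"
    and "\<forall>i. 0 \<le> z0 $ i"
    and "srbm M F (cov_matrix \<rho>) \<mu> (refl_matrix r1 r2) z0 Z B L"
    and "Re x < 0" and "Re y < 0" and "Re u < 0"
  shows "path_expectation_exists M (\<lambda>_. lborel) (integrand Z u x y) \<and>
    path_expectation_exists M (\<lambda>\<omega>. stieltjes (\<lambda>s. L s \<omega> $ 1)) (integrand Z u 0 y) \<and>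
    path_expectation_exists M (\<lambda>\<omega>. stieltjes (\<lambda>s. L s \<omega> $ 2)) (integrand Z u x 0) \<and>
    - (kernel_K \<rho> \<mu> x y + u) * p_hat M Z u x y =
      kernel_k1 r1 x y * p1_hat M Z L u y + kernel_k2 r2 x y * p2_hat M Z L u x
      + exp (x * of_real (z0 $ 1) + y * of_real (z0 $ 2))"
proof -
  interpret planar_srbm M F Z B L z0 \<mu> \<rho> r1 r2
    by unfold_locales (use assms in auto)
  show ?thesis
    by (intro conjI functional_equation[OF assms(4,7-9)])
qed

end
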